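(* Let $d\ge 2$ and $U=U(S_{\rm std},\mathcal{P}_{\rm std},G_{2d})$ acting on $\ell^2(\mathbb{Z}^d,\mathbb{C}^{2d})$. Then both $1$ and $-1$ are eigenvalues of $U$ and $U$ has no other eigenvalues. Let $\Pi_\pm$ be the orthogonal projections onto the eigenspaces of $U$ for the eigenvalues $\pm1$. Then for every $\phi\in\mathbb{C}^{2d}$ and $x\in\mathbb{Z}^d$, $$\lim_{N\to\infty}\frac1N\sum_{n=1}^N p_n(\phi;x)=\|\Pi_+(\delta_0\otimes\phi)(x)\|^2_{\mathbb{C}^{2d}}+\|\Pi_-(\delta_0\otimes\phi)(x)\|^2_{\mathbb{C}^{2d}}.$$ In particular there exist $\phi_o\in\mathbb{C}^{2d}$ and $x_o\in\mathbb{Z}^d$ with $\limsup_{n\to\infty}p_n(\phi_o;x_o)>0$.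
   Context: Let $u_1,\dots,u_d$ be the standard basis of $\mathbb{Z}^d$ and $\mathbf{e}_1,\dots,\mathbf{e}_{2d}$ the standard basis of $\mathbb{C}^{2d}$; $P_j$ is the orthogonal projection onto $\mathbb{C}\mathbf{e}_j$. $S_{\rm std}=\{\pm u_1,\dots,\pm u_d\}$, $\mathcal{P}_{\rm std}=\{P_\alpha\}_{\alpha\in S_{\rm std}}$ with $P_{u_j}=P_{2j-1}$, $P_{-u_j}=P_{2j}$. For $\alpha\in\mathbb{Z}^d$, $(\tau^\alpha f)(x)=f(x-\alpha)$ on $\ell^2(\mathbb{Z}^d,\mathbb{C}^{2d})$. For a unitary $2d\times2d$ matrix $C$ acting pointwise, $U(S_{\rm std},\mathcal{P}_{\rm std},C)=\big(\sum_{\alpha\in S_{\rm std}}\tau^\alpha P_\alpha\big)C$. The Grover matrix is $G_D=\frac2D J-I$, where $J$ is the $D\times D$ all-ones matrix. For $\phi\in\mathbb{C}^{2d}$, $\delta_0\otimes\phi$ equals $\phi$ at $0$ and $0$ elsewhere, and $p_n(\phi;x)=\|U^n(\delta_0\otimes\phi)(x)\|^2$. Eigenvalue means element of the point spectrum. *)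

theory Defs
  imports "HOL-Analysis.Analysis"
begin

text \<open>Lattice sites of Z^d are functions 'd => int (with 'd a finite index type, CARD('d) = d).
  Vectors of C^{2d} are functions on 'd \<times> bool: the component (j,True) corresponds to the
  basis vector for direction +u_j (index 2j-1), (j,False) to -u_j (index 2j).
  Wave functions on Z^d with values in C^{2d} are functions site => vector.\<close>

definition vnorm2 :: "('d::finite \<times> bool \<Rightarrow> complex) \<Rightarrow> real" where
  "vnorm2 v = (\<Sum>c\<in>UNIV. (cmod (v c))\<^sup>2)"

definition in_ell2 :: "(('d::finite \<Rightarrow> int) \<Rightarrow> ('d \<times> bool \<Rightarrow> complex)) \<Rightarrow> bool" where
  "in_ell2 f \<longleftrightarrow> (\<lambda>x. vnorm2 (f x)) summable_on UNIV"

definition ell2_inner ::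
  "(('d::finite \<Rightarrow> int) \<Rightarrow> ('d \<times> bool \<Rightarrow> complex)) \<Rightarrow> (('d \<Rightarrow> int) \<Rightarrow> ('d \<times> bool \<Rightarrow> complex)) \<Rightarrow> complex" where
  "ell2_inner f g = (\<Sum>\<^sub>\<infinity>x. \<Sum>c\<in>UNIV. cnj (f x c) * g x c)"

definition std_dir :: "'d \<times> bool \<Rightarrow> ('d \<Rightarrow> int)" where
  "std_dir c = (\<lambda>i. if i = fst c then (if snd c then 1 else -1) else 0)"

definition grover :: "('d::finite \<times> bool \<Rightarrow> complex) \<Rightarrow> ('d \<times> bool \<Rightarrow> complex)" where
  "grover v = (\<lambda>c. (2 / of_nat CARD('d \<times> bool)) * (\<Sum>b\<in>UNIV. v b) - v c)"

text \<open>U(S_std, P_std, G_{2d}) = (sum_alpha tau^alpha P_alpha) C, C = G_{2d} pointwise: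
  (U f)(x) component c = (C f(x - alpha_c)) component c.\<close>
definition U_std ::
  "(('d::finite \<Rightarrow> int) \<Rightarrow> ('d \<times> bool \<Rightarrow> complex)) \<Rightarrow> (('d \<Rightarrow> int) \<Rightarrow> ('d \<times> bool \<Rightarrow> complex))" where
  "U_std f = (\<lambda>x c. grover (f (\<lambda>i. x i - std_dir c i)) c)"

definition eigenspace_U :: "complex \<Rightarrow> (('d::finite \<Rightarrow> int) \<Rightarrow> ('d \<times> bool \<Rightarrow> complex)) set" where
  "eigenspace_U mu = {f. in_ell2 f \<and> U_std f = (\<lambda>x c. mu * f x c)}"

definition is_eigenvalue_U :: "'d::finite itself \<Rightarrow> complex \<Rightarrow> bool" where
  "is_eigenvalue_U _ mu \<longleftrightarrow> (\<exists>f::('d \<Rightarrow> int) \<Rightarrow> ('d \<times> bool \<Rightarrow> complex).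
      f \<in> eigenspace_U mu \<and> f \<noteq> (\<lambda>x c. 0))"

definition orth_proj ::
  "(('d::finite \<Rightarrow> int) \<Rightarrow> ('d \<times> bool \<Rightarrow> complex)) set \<Rightarrow> (('d \<Rightarrow> int) \<Rightarrow> ('d \<times> bool \<Rightarrow> complex))
     \<Rightarrow> (('d \<Rightarrow> int) \<Rightarrow> ('d \<times> bool \<Rightarrow> complex))" where
  "orth_proj E f = (THE g. g \<in> E \<and> (\<forall>h\<in>E. ell2_inner h (\<lambda>x c. f x c - g x c) = 0))"

definition delta0 :: "('d::finite \<times> bool \<Rightarrow> complex) \<Rightarrow> (('d \<Rightarrow> int) \<Rightarrow> ('d \<times> bool \<Rightarrow> complex))" where
  "delta0 \<phi> = (\<lambda>x. if x = (\<lambda>i. 0) then \<phi> else (\<lambda>c. 0))"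

definition p_std :: "nat \<Rightarrow> ('d::finite \<times> bool \<Rightarrow> complex) \<Rightarrow> ('d \<Rightarrow> int) \<Rightarrow> real" where
  "p_std n \<phi> x = vnorm2 ((U_std ^^ n) (delta0 \<phi>) x)"

end

theory Submission
  imports Defs "HOL-Probability.Probability" "HOL-Computational_Algebra.Fundamental_Theorem_Algebra"
begin

text \<open>Let $W$ be the closed subspace of states whose amplitudes tend to 0 in quadratic time mean.
  If $W$ contains $(U^2 - 1)\delta$ for every point mass $\delta$, then the residual of the
  projection onto $W$ is fixed by $U^2$, hence is a sum of eigenvectors for $\pm 1$, and
  these are orthogonal to $W$. This gives the projections, the time averages and, since an
  eigenvector for another eigenvalue would have a constant nonzero time mean, the point spectrum.

  For the mixing of $(U^2 - 1)\delta$, note that for each momentum $k$ the Fourier transformed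
  orbit satisfies a scalar linear recurrence in time. The squared amplitude is an integral
  over pairs $(k, k')$ of products of two bounded orbits, and the time mean of such a product vanishes
  when the characteristic polynomials at $k$ and $k'$ are coprime. For fixed $k'$ this holds
  for almost every $k$, as a given complex number is a root at $k$ only for $k$ in a null
  set.\<close>

section \<open>Quadratic means and isometries of Hilbert spaces\<close>

text \<open>The factor \<open>U^2 - 1\<close> is forced: at every momentum the fibre of the walk has
  the eigenvalues 1 and -1, so the characteristic polynomials at two momenta always share these
  roots and the two orbits need not decorrelate. What is left after removing this factor has roots
  that move with the momentum. The sequences \<open>z^n\<close> and \<open>w^n\<close> resonate when
  \<open>z * w = 1\<close>, which is why the coprimality condition pairs \<open>z\<close> with
  \<open>1 / z\<close>; the conjugated orbit at the second momentum keeps its polynomial, whose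
  coefficients are real.

  Scalar recurrences avoid diagonalising the fibres, so neither multiplicities nor a measurable
  choice of eigenvectors enter. Only point masses are Fourier transformed; totality carries the
  mixing over to all states.

  The residual \<open>r\<close> is orthogonal to every \<open>U^2 b - b\<close>. Writing
  \<open>r = U^2 s\<close>, the isometry turns this into orthogonality of \<open>s - r\<close> to
  every point mass, so \<open>s = r\<close>. Surjectivity of \<open>U\<close> thus stands in for its
  adjoint.\<close>

definition null_mean_square :: "(nat \<Rightarrow> 'a::real_normed_vector) \<Rightarrow> bool" where
  "null_mean_square a \<longleftrightarrow> (\<lambda>N. (1 / real N) * (\<Sum>n=1..N. (norm (a n))\<^sup>2)) \<longlonglongrightarrow> 0"

lemma null_mean_square_le:
  assumes b: "null_mean_square b" and le: "\<And>n. norm (a n) \<le> C * norm (b n)"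
  shows "null_mean_square a"
  unfolding null_mean_square_def
proof (rule Lim_null_comparison)
  show "\<forall>\<^sub>F N in sequentially. norm ((1 / real N) * (\<Sum>n=1..N. (norm (a n))\<^sup>2))
      \<le> C\<^sup>2 * ((1 / real N) * (\<Sum>n=1..N. (norm (b n))\<^sup>2))"
  proof (intro always_eventually allI)
    fix N
    have "(\<Sum>n=1..N. (norm (a n))\<^sup>2) \<le> (\<Sum>n=1..N. C\<^sup>2 * (norm (b n))\<^sup>2)"
      by (intro sum_mono) (metis le norm_ge_zero power_mono power_mult_distrib)
    then have "(\<Sum>n=1..N. (norm (a n))\<^sup>2) \<le> C\<^sup>2 * (\<Sum>n=1..N. (norm (b n))\<^sup>2)"
      by (simp add: sum_distrib_left)
    then have "(1 / real N) * (\<Sum>n=1..N. (norm (a n))\<^sup>2) \<le> (1 / real N) * (C\<^sup>2 * (\<Sum>n=1..N. (norm (b n))\<^sup>2))"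
      by (intro mult_left_mono) auto
    then show "norm ((1 / real N) * (\<Sum>n=1..N. (norm (a n))\<^sup>2))
      \<le> C\<^sup>2 * ((1 / real N) * (\<Sum>n=1..N. (norm (b n))\<^sup>2))"
      by (simp add: sum_nonneg mult.commute mult.left_commute)
  qed
  show "(\<lambda>N. C\<^sup>2 * ((1 / real N) * (\<Sum>n=1..N. (norm (b n))\<^sup>2))) \<longlonglongrightarrow> 0"
    using tendsto_mult_left[OF b[unfolded null_mean_square_def], of "C\<^sup>2"] by simp
qed

lemma norm_add_square_le: "(norm (x + y))\<^sup>2 \<le> 2 * (norm x)\<^sup>2 + 2 * (norm (y::'a::real_normed_vector))\<^sup>2"
proof -
  have "(norm (x + y))\<^sup>2 \<le> (norm x + norm y)\<^sup>2"
    by (intro power_mono norm_triangle_ineq) auto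
  also have "\<dots> \<le> 2 * (norm x)\<^sup>2 + 2 * (norm y)\<^sup>2"
    using sum_squares_bound[of "norm x" "norm y"] by (simp add: power2_sum)
  finally show ?thesis .
qed

lemma mean_square_add_le:
  fixes a b :: "nat \<Rightarrow> 'a::real_normed_vector"
  shows "(1 / real N) * (\<Sum>n=1..N. (norm (a n + b n))\<^sup>2)
    \<le> 2 * ((1 / real N) * (\<Sum>n=1..N. (norm (a n))\<^sup>2)) + 2 * ((1 / real N) * (\<Sum>n=1..N. (norm (b n))\<^sup>2))"
proof -
  have "(\<Sum>n=1..N. (norm (a n + b n))\<^sup>2) \<le> (\<Sum>n=1..N. 2 * (norm (a n))\<^sup>2 + 2 * (norm (b n))\<^sup>2)"
    by (intro sum_mono norm_add_square_le)
  also have "\<dots> = 2 * (\<Sum>n=1..N. (norm (a n))\<^sup>2) + 2 * (\<Sum>n=1..N. (norm (b n))\<^sup>2)"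
    by (simp add: sum.distrib sum_distrib_left)
  finally have "(1 / real N) * (\<Sum>n=1..N. (norm (a n + b n))\<^sup>2)
     \<le> (1 / real N) * (2 * (\<Sum>n=1..N. (norm (a n))\<^sup>2) + 2 * (\<Sum>n=1..N. (norm (b n))\<^sup>2))"
    by (intro mult_left_mono) auto
  then show ?thesis by (simp add: algebra_simps)
qed

lemma null_mean_square_add:
  assumes "null_mean_square a" "null_mean_square b"
  shows "null_mean_square (\<lambda>n. a n + b n)"
  unfolding null_mean_square_def
proof (rule tendsto_sandwich[OF _ _ tendsto_const])
  show "(\<lambda>N. 2 * ((1 / real N) * (\<Sum>n=1..N. (norm (a n))\<^sup>2)) + 2 * ((1 / real N) * (\<Sum>n=1..N. (norm (b n))\<^sup>2))) \<longlonglongrightarrow> 0"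
    using tendsto_add[OF tendsto_mult_left[OF assms(1)[unfolded null_mean_square_def], of 2]
        tendsto_mult_left[OF assms(2)[unfolded null_mean_square_def], of 2]] by simp
  show "\<forall>\<^sub>F N in sequentially. 0 \<le> (1 / real N) * (\<Sum>n=1..N. (norm (a n + b n))\<^sup>2)"
    by (intro always_eventually allI mult_nonneg_nonneg sum_nonneg) auto
  show "\<forall>\<^sub>F N in sequentially. (1 / real N) * (\<Sum>n=1..N. (norm (a n + b n))\<^sup>2)
    \<le> 2 * ((1 / real N) * (\<Sum>n=1..N. (norm (a n))\<^sup>2)) + 2 * ((1 / real N) * (\<Sum>n=1..N. (norm (b n))\<^sup>2))"
    by (intro always_eventually allI mean_square_add_le)
qed

lemma mean_le:
  fixes f :: "nat \<Rightarrow> real"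
  assumes "\<And>n. f n \<le> c" "0 \<le> c"
  shows "(1 / real N) * (\<Sum>n=1..N. f n) \<le> c"
proof (cases "N = 0")
  case False
  have "(\<Sum>n=1..N. f n) \<le> real N * c"
    using sum_bounded_above[of "{1..N}" f c] assms(1) by simp
  with False show ?thesis by (simp add: divide_le_eq mult.commute)
qed (use assms(2) in simp)

lemma null_mean_square_approx:
  fixes a :: "nat \<Rightarrow> 'a::real_normed_vector"
  assumes "\<And>e. 0 < e \<Longrightarrow> \<exists>b. null_mean_square b \<and> (\<forall>n. norm (a n - b n) \<le> e)"
  shows "null_mean_square a"
  unfolding null_mean_square_def
proof (rule LIMSEQ_I)
  fix r :: real assume r: "0 < r"
  \<comment> \<open>\<open>mean_square_add_le\<close> doubles both means, so each of them may use a
    quarter of \<open>r\<close>.\<close>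
  define e where "e = sqrt (r / 4)"
  have e: "0 < e" "e\<^sup>2 = r / 4" using r by (auto simp: e_def)
  obtain b where b: "null_mean_square b" "\<And>n. norm (a n - b n) \<le> e"
    using assms[OF e(1)] by blast
  obtain N0 where N0: "\<And>N. N \<ge> N0 \<Longrightarrow> norm ((1 / real N) * (\<Sum>n=1..N. (norm (b n))\<^sup>2) - 0) < r / 4"
    using LIMSEQ_D[OF b(1)[unfolded null_mean_square_def], of "r / 4"] r by auto
  show "\<exists>N0. \<forall>N\<ge>N0. norm ((1 / real N) * (\<Sum>n=1..N. (norm (a n))\<^sup>2) - 0) < r"
  proof (intro exI allI impI)
    fix N assume "N \<ge> N0"
    then have 1: "(1 / real N) * (\<Sum>n=1..N. (norm (b n))\<^sup>2) < r / 4"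
      using N0[of N] by (simp only: real_norm_def abs_less_iff diff_zero)
    have 2: "(1 / real N) * (\<Sum>n=1..N. (norm (a n - b n))\<^sup>2) \<le> r / 4"
      using b(2) r by (intro mean_le) (auto simp: e(2)[symmetric] intro: power_mono)
    have "(1 / real N) * (\<Sum>n=1..N. (norm (a n))\<^sup>2) < r"
      using mean_square_add_le[of N "\<lambda>n. a n - b n" b] 1 2 r
      by (simp only: diff_add_cancel)
    then show "norm ((1 / real N) * (\<Sum>n=1..N. (norm (a n))\<^sup>2) - 0) < r"
      by (simp add: sum_nonneg)
  qed
qed

lemma mean_const: "(\<lambda>N. (1 / real N) * (\<Sum>n=1..N. c)) \<longlonglongrightarrow> (c::real)"
proof (rule tendsto_eventually)
  show "\<forall>\<^sub>F N in sequentially. (1 / real N) * (\<Sum>n=1..N. c) = c"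
    using eventually_gt_at_top[of 0] by eventually_elim simp
qed

lemma null_mean_square_const:
  assumes "null_mean_square (\<lambda>n. c)"
  shows "c = 0"
proof -
  have "(norm c)\<^sup>2 = 0"
    using LIMSEQ_unique[OF mean_const assms[unfolded null_mean_square_def]] .
  then show ?thesis by simp
qed

lemma null_mean_square_LIMSEQ_0:
  assumes "a \<longlonglongrightarrow> 0"
  shows "null_mean_square a"
proof (rule null_mean_square_approx)
  fix e :: real assume e: "0 < e"
  then obtain N0 where N0: "\<And>n. n \<ge> N0 \<Longrightarrow> norm (a n) < e"
    using LIMSEQ_D[OF assms e] by auto
  \<comment> \<open>Only finitely many terms survive, so their sum is bounded and its mean decays
    like \<open>1 / N\<close>.\<close>
  define b where "b n = (if n < N0 then a n else 0)" for n
  have "null_mean_square b" unfolding null_mean_square_def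
  proof (rule Lim_null_comparison)
    show "\<forall>\<^sub>F N in sequentially. norm ((1 / real N) * (\<Sum>n=1..N. (norm (b n))\<^sup>2))
      \<le> (\<Sum>n<N0. (norm (a n))\<^sup>2) / real N"
    proof (intro always_eventually allI)
      fix N
      have "(\<Sum>n=1..N. (norm (b n))\<^sup>2) = (\<Sum>n\<in>{1..N} \<inter> {..<N0}. (norm (a n))\<^sup>2)"
        by (subst sum.inter_restrict) (auto simp: b_def intro!: sum.cong)
      also have "\<dots> \<le> (\<Sum>n<N0. (norm (a n))\<^sup>2)"
        by (intro sum_mono2) auto
      finally show "norm ((1 / real N) * (\<Sum>n=1..N. (norm (b n))\<^sup>2)) \<le> (\<Sum>n<N0. (norm (a n))\<^sup>2) / real N"
        by (simp add: sum_nonneg divide_right_mono)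
    qed
  qed (rule lim_const_over_n)
  moreover have "norm (a n - b n) \<le> e" for n
    using N0[of n] e by (auto simp: b_def)
  ultimately show "\<exists>b. null_mean_square b \<and> (\<forall>n. norm (a n - b n) \<le> e)" by blast
qed

text \<open>Cauchy-Schwarz against the constant sequence 1 bounds the mean of
  \<open>norm (a n)\<close> by the root of the mean square.\<close>

lemma null_mean_square_mult_bounded:
  fixes a :: "nat \<Rightarrow> 'a::real_normed_field"
  assumes a: "null_mean_square a" and b: "\<And>n. norm (b n) \<le> C"
  shows "(\<lambda>N. (1 / of_nat N) * (\<Sum>n=1..N. a n * b n)) \<longlonglongrightarrow> 0"
proof (rule Lim_null_comparison)
  have C: "0 \<le> C" using b[of 0] norm_ge_zero order.trans by blast
  show "\<forall>\<^sub>F N in sequentially. norm ((1 / of_nat N) * (\<Sum>n=1..N. a n * b n))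
      \<le> C * sqrt ((1 / real N) * (\<Sum>n=1..N. (norm (a n))\<^sup>2))"
  proof (intro always_eventually allI)
    fix N
    have "norm (\<Sum>n=1..N. a n * b n) \<le> (\<Sum>n=1..N. norm (a n) * C)"
      by (intro sum_norm_le) (auto simp: norm_mult intro: mult_left_mono b)
    also have "\<dots> = C * (\<Sum>n=1..N. norm (a n) * 1)" by (simp add: sum_distrib_left mult.commute)
    also have "\<dots> \<le> C * sqrt (real N * (\<Sum>n=1..N. (norm (a n))\<^sup>2))"
      using Cauchy_Schwarz_ineq_sum[of "\<lambda>n. norm (a n)" "\<lambda>n. 1" "{1..N}"] C
      by (intro mult_left_mono real_le_rsqrt) (auto simp: mult.commute)
    finally have *: "(1 / real N) * norm (\<Sum>n=1..N. a n * b n)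
       \<le> (1 / real N) * (C * sqrt (real N * (\<Sum>n=1..N. (norm (a n))\<^sup>2)))"
      by (intro mult_left_mono) auto
    have **: "(1 / real N) * sqrt (real N * (\<Sum>n=1..N. (norm (a n))\<^sup>2)) = sqrt ((1 / real N) * (\<Sum>n=1..N. (norm (a n))\<^sup>2))"
    proof -
      have "(1 / real N) * sqrt (real N * (\<Sum>n=1..N. (norm (a n))\<^sup>2))
          = (sqrt (real N) / real N) * sqrt (\<Sum>n=1..N. (norm (a n))\<^sup>2)"
        by (simp add: real_sqrt_mult del: One_nat_def)
      then show ?thesis
        by (simp only: sqrt_divide_self_eq[of "real N"] of_nat_0_le_iff)
           (simp add: real_sqrt_divide inverse_eq_divide del: One_nat_def)
    qed
    have "(1 / real N) * (C * sqrt (real N * (\<Sum>n=1..N. (norm (a n))\<^sup>2)))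
        = C * sqrt ((1 / real N) * (\<Sum>n=1..N. (norm (a n))\<^sup>2))"
      by (subst **[symmetric]) (simp only: ac_simps)
    with * show "norm ((1 / of_nat N) * (\<Sum>n=1..N. a n * b n))
      \<le> C * sqrt ((1 / real N) * (\<Sum>n=1..N. (norm (a n))\<^sup>2))"
      by (simp only: norm_mult norm_divide norm_one norm_of_nat)
  qed
  show "(\<lambda>N. C * sqrt ((1 / real N) * (\<Sum>n=1..N. (norm (a n))\<^sup>2))) \<longlonglongrightarrow> 0"
    using tendsto_mult_left[OF tendsto_real_sqrt[OF a[unfolded null_mean_square_def]], of C] by simp
qed

section \<open>Orthogonal projection and weak mixing in real Hilbert spaces\<close>

lemma closed_subspace_projection:
  fixes S :: "'a::{real_inner,complete_space} set"
  assumes S: "subspace S" and cl: "closed S"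
  shows "\<exists>w\<in>S. \<forall>v\<in>S. inner (f - w) v = 0"
proof -
  define D where "D = (INF w\<in>S. (norm (f - w))\<^sup>2)"
  have ne: "S \<noteq> {}" using subspace_0[OF S] by auto
  have bdd: "bdd_below ((\<lambda>w. (norm (f - w))\<^sup>2) ` S)" by (rule bdd_belowI[of _ 0]) auto
  have D_le: "D \<le> (norm (f - w))\<^sup>2" if "w \<in> S" for w
    unfolding D_def by (rule cINF_lower[OF bdd that])
  have "\<exists>w\<in>S. (norm (f - w))\<^sup>2 < D + 1 / real (Suc n)" for n
    using cINF_less_iff[OF ne bdd, of "D + 1 / real (Suc n)"] unfolding D_def by auto
  then obtain w where w: "\<And>n. w n \<in> S" "\<And>n. (norm (f - w n))\<^sup>2 < D + 1 / real (Suc n)"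
    by metis
  \<comment> \<open>Parallelogram law: the midpoint of \<open>w m\<close> and \<open>w n\<close>
    lies in \<open>S\<close>, so its squared distance from \<open>f\<close> is at least
    \<open>D\<close>. This makes the minimising sequence Cauchy.\<close>
  have par: "(norm (w m - w n))\<^sup>2 \<le> 2 / real (Suc m) + 2 / real (Suc n)" for m n
  proof -
    have "(1/2) *\<^sub>R (w m + w n) \<in> S" using w S by (simp add: subspace_add subspace_scale)
    then have "D \<le> (norm (f - (1/2) *\<^sub>R (w m + w n)))\<^sup>2" by (rule D_le)
    moreover have "f - (1/2) *\<^sub>R (w m + w n) = (1/2) *\<^sub>R ((f - w m) + (f - w n))"
      by (simp add: algebra_simps) (metis scaleR_half_double scaleR_add_right)
    then have "(norm (f - (1/2) *\<^sub>R (w m + w n)))\<^sup>2 = (norm ((f - w m) + (f - w n)))\<^sup>2 / 4"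
      by (simp add: power_mult_distrib power_divide)
    moreover have "(norm (w m - w n))\<^sup>2 + (norm ((f - w m) + (f - w n)))\<^sup>2
        = 2 * (norm (f - w m))\<^sup>2 + 2 * (norm (f - w n))\<^sup>2"
      by (simp add: power2_norm_eq_inner inner_diff_left inner_diff_right inner_add_left inner_add_right inner_commute algebra_simps)
    ultimately show ?thesis using w(2)[of m] w(2)[of n] by simp
  qed
  have "Cauchy w"
  proof (rule metric_CauchyI)
    fix e :: real assume e: "0 < e"
    obtain M where M: "4 / e\<^sup>2 < real M" using reals_Archimedean2 by blast
    show "\<exists>M. \<forall>m\<ge>M. \<forall>n\<ge>M. dist (w m) (w n) < e"
    proof (intro exI allI impI)
      fix m n assume mn: "M \<le> m" "M \<le> n"
      have "2 / real (Suc k) < e\<^sup>2 / 2" if "M \<le> k" for k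
      proof -
        have "4 / e\<^sup>2 < real (Suc k)" using M that by linarith
        then show ?thesis using e by (simp add: field_simps)
      qed
      from this[OF mn(1)] this[OF mn(2)] par[of m n] have "(norm (w m - w n))\<^sup>2 < e\<^sup>2"
        by linarith
      then show "dist (w m) (w n) < e" using e by (simp add: dist_norm power_less_imp_less_base)
    qed
  qed
  then obtain w0 where w0: "w \<longlonglongrightarrow> w0" using Cauchy_convergent convergent_def by blast
  have w0S: "w0 \<in> S" using closed_sequentially[OF cl _ w0] w(1) by blast
  have "(norm (f - w0))\<^sup>2 \<le> D"
  proof (rule LIMSEQ_le)
    show "(\<lambda>n. (norm (f - w n))\<^sup>2) \<longlonglongrightarrow> (norm (f - w0))\<^sup>2" by (intro tendsto_intros w0)
    show "(\<lambda>n. D + 1 / real (Suc n)) \<longlonglongrightarrow> D"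
      using tendsto_add[OF tendsto_const LIMSEQ_inverse_real_of_nat, of D] by (simp add: inverse_eq_divide)
  qed (use w(2) less_imp_le in blast)
  have "inner (f - w0) v = 0" if v: "v \<in> S" for v
  proof (cases "v = 0")
    case False
    \<comment> \<open>The minimiser of the squared distance from \<open>f\<close> along the line
      \<open>w0 + t *\<^sub>R v\<close>; minimality of \<open>w0\<close> then forces
      \<open>t = 0\<close>.\<close>
    define t where "t = inner (f - w0) v / inner v v"
    have vv: "inner v v > 0" using False by simp
    have "w0 + t *\<^sub>R v \<in> S" using w0S v S by (simp add: subspace_add subspace_scale)
    then have "(norm (f - w0))\<^sup>2 \<le> (norm (f - (w0 + t *\<^sub>R v)))\<^sup>2"
      using D_le \<open>(norm (f - w0))\<^sup>2 \<le> D\<close> order.trans by blast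
    also have "\<dots> = (norm (f - w0))\<^sup>2 - 2 * t * inner (f - w0) v + t\<^sup>2 * inner v v"
      unfolding power2_norm_eq_inner power2_eq_square[of t]
      by (simp add: inner_diff_left inner_diff_right inner_add_left inner_add_right inner_commute algebra_simps)
    also have "\<dots> = (norm (f - w0))\<^sup>2 - (inner (f - w0) v)\<^sup>2 / inner v v"
      using vv by (simp add: t_def power2_eq_square field_simps)
    finally have "(inner (f - w0) v)\<^sup>2 / inner v v \<le> 0" by simp
    then show ?thesis using vv by (simp add: divide_le_0_iff)
  qed simp
  with w0S show ?thesis by blast
qed

text \<open>The residual of the projection onto \<open>S\<close> is orthogonal to \<open>B\<close>,
  hence 0. Totality in this dual form spares any approximation by finite linear
  combinations.\<close>

lemma closed_subspace_eq_UNIV: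
  fixes S :: "'a::{real_inner,complete_space} set"
  assumes "subspace S" "closed S" "B \<subseteq> S" and tot: "\<And>r. (\<And>b. b \<in> B \<Longrightarrow> inner b r = 0) \<Longrightarrow> r = 0"
  shows "S = UNIV"
proof -
  have "f \<in> S" for f
  proof -
    obtain w where w: "w \<in> S" "\<And>v. v \<in> S \<Longrightarrow> inner (f - w) v = 0"
      using closed_subspace_projection[OF assms(1,2)] by metis
    have "f - w = 0" by (rule tot) (use w(2) assms(3) in \<open>auto simp: inner_commute\<close>)
    with w(1) show ?thesis by simp
  qed
  then show ?thesis by auto
qed

text \<open>The bound \<open>C\<close> is uniform in \<open>n\<close>, so approximating
  \<open>x\<close> approximates the whole sequence uniformly in time, as
  \<open>null_mean_square_approx\<close> requires. It serves both for the state and for the test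
  vector.\<close>

lemma weakly_null_closed_subspace:
  fixes T :: "nat \<Rightarrow> 'a::real_normed_vector \<Rightarrow> 'b::real_normed_vector"
  assumes lin: "\<And>n. linear (T n)" and bd: "\<And>n x. norm (T n x) \<le> C * norm x"
  shows "subspace {x. null_mean_square (\<lambda>n. T n x)}" "closed {x. null_mean_square (\<lambda>n. T n x)}"
proof -
  show "subspace {x. null_mean_square (\<lambda>n. T n x)}"
  proof (rule subspaceI)
    show "0 \<in> {x. null_mean_square (\<lambda>n. T n x)}"
      by (simp add: linear_0[OF lin] null_mean_square_def)
    show "x + y \<in> {x. null_mean_square (\<lambda>n. T n x)}"
      if "x \<in> {x. null_mean_square (\<lambda>n. T n x)}" "y \<in> {x. null_mean_square (\<lambda>n. T n x)}" for x y
      using null_mean_square_add that by (simp add: linear_add[OF lin])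
    show "c *\<^sub>R x \<in> {x. null_mean_square (\<lambda>n. T n x)}"
      if "x \<in> {x. null_mean_square (\<lambda>n. T n x)}" for c x
      using that null_mean_square_le[of "\<lambda>n. T n x" "\<lambda>n. T n (c *\<^sub>R x)" "\<bar>c\<bar>"]
      by (simp add: linear_scale[OF lin])
  qed
  show "closed {x. null_mean_square (\<lambda>n. T n x)}"
    unfolding closed_sequential_limits
  proof (intro allI impI, elim conjE)
    fix X l assume X: "\<forall>k. X k \<in> {x. null_mean_square (\<lambda>n. T n x)}" "X \<longlonglongrightarrow> l"
    have "null_mean_square (\<lambda>n. T n l)"
    proof (rule null_mean_square_approx)
      fix e :: real assume e: "0 < e"
      have "(\<lambda>k. C * norm (l - X k)) \<longlonglongrightarrow> C * norm (l - l)" by (intro tendsto_intros X(2))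
      then have "\<forall>\<^sub>F k in sequentially. C * norm (l - X k) < e" using e by (intro order_tendstoD(2)) auto
      then obtain k where k: "C * norm (l - X k) < e" using eventually_sequentially by auto
      have "norm (T n l - T n (X k)) \<le> e" for n
        using bd[of n "l - X k"] k by (simp add: linear_diff[OF lin])
      with X(1) show "\<exists>b. null_mean_square b \<and> (\<forall>n. norm (T n l - b n) \<le> e)" by blast
    qed
    then show "l \<in> {x. null_mean_square (\<lambda>n. T n x)}" by simp
  qed
qed

lemma isometry_inner:
  fixes U :: "'a::real_inner \<Rightarrow> 'b::real_inner"
  assumes "linear U" "\<And>x. norm (U x) = norm x"
  shows "inner (U x) (U y) = inner x y"
proof -
  have "(norm (U (x + y)))\<^sup>2 = (norm (x + y))\<^sup>2" "(norm (U x))\<^sup>2 = (norm x)\<^sup>2" "(norm (U y))\<^sup>2 = (norm y)\<^sup>2"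
    using assms(2) by simp_all
  then show ?thesis
    by (simp add: linear_add[OF assms(1)] power2_norm_eq_inner inner_add_left inner_add_right inner_commute)
qed

lemma linear_funpow: "linear (U ^^ n)" if "linear U" for U :: "'a::real_vector \<Rightarrow> 'a"
  using that by (induction n) (auto intro: linear_compose simp: linear_id)

text \<open>Mixing is asked only for pairs from \<open>B\<close>, the matrix elements that a Fourier
  integral can reach; the conclusion concerns arbitrary states and test vectors.\<close>

lemma isometry_decomposition:
  fixes U :: "'a::{real_inner,complete_space} \<Rightarrow> 'a" and B :: "'a set"
  assumes lin: "linear U" and iso: "\<And>x. norm (U x) = norm x" and sur: "surj U"
    and tot: "\<And>r. (\<And>b. b \<in> B \<Longrightarrow> inner b r = 0) \<Longrightarrow> r = 0"
    and mix: "\<And>b b'. b \<in> B \<Longrightarrow> b' \<in> B \<Longrightarrow> null_mean_square (\<lambda>n. inner b ((U ^^ n) (U (U b') - b')))"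
  obtains g h w where "f = g + h + w" "U g = g" "U h = - h"
    "\<And>e. null_mean_square (\<lambda>n. inner e ((U ^^ n) w))"
proof -
  have linn: "linear (U ^^ n)" for n using linear_funpow[OF lin] .
  have ison: "norm ((U ^^ n) x) = norm x" for n x by (induction n) (auto simp: iso)
  define W where "W = {w. \<forall>e. null_mean_square (\<lambda>n. inner e ((U ^^ n) w))}"
  have W_eq: "W = (\<Inter>e. {w. null_mean_square (\<lambda>n. inner e ((U ^^ n) w))})" by (auto simp: W_def)
  have le: "linear (\<lambda>x. inner e ((U ^^ n) x))" for e n
    by (rule linearI) (auto simp: linear_add[OF linn] linear_scale[OF linn] inner_add_right)
  have be: "norm (inner e ((U ^^ n) x)) \<le> norm e * norm x" for e n x
    using Cauchy_Schwarz_ineq2[of e "(U ^^ n) x"] by (simp add: ison)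
  have W: "subspace W" "closed W"
    unfolding W_eq using weakly_null_closed_subspace[OF le be] by (auto intro!: subspace_Inter closed_INT)
  \<comment> \<open>The state is fixed here and the test vector varies: the admissible test vectors
    form a closed subspace containing \<open>B\<close>.\<close>
  have mixW: "U (U b) - b \<in> W" if b: "b \<in> B" for b
  proof -
    define w where "w = U (U b) - b"
    have l2: "linear (\<lambda>e. inner e ((U ^^ n) w))" for n
      by (rule linearI) (auto simp: inner_add_left)
    have b2: "norm (inner e ((U ^^ n) w)) \<le> norm w * norm e" for e n
      using Cauchy_Schwarz_ineq2[of e "(U ^^ n) w"] by (simp add: ison mult.commute)
    have "{e. null_mean_square (\<lambda>n. inner e ((U ^^ n) w))} = UNIV"
    proof (rule closed_subspace_eq_UNIV)
      show "B \<subseteq> {e. null_mean_square (\<lambda>n. inner e ((U ^^ n) w))}"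
        using mix[OF _ b] by (auto simp: w_def)
      show "r = 0" if "\<And>b. b \<in> B \<Longrightarrow> inner b r = 0" for r by (rule tot[OF that])
    qed (use weakly_null_closed_subspace[OF l2 b2] in auto)
    then show ?thesis by (auto simp: W_def w_def)
  qed
  obtain w where w: "w \<in> W" "\<And>v. v \<in> W \<Longrightarrow> inner (f - w) v = 0"
    using closed_subspace_projection[OF W] by metis
  define r where "r = f - w"
  obtain s where s: "U (U s) = r" using sur by (metis surjD)
  have "s - r = 0"
  proof (rule tot)
    fix b assume "b \<in> B"
    then have "inner (U (U b)) r = inner b r"
      using w(2)[OF mixW] by (simp add: r_def inner_diff_right inner_commute)
    then show "inner b (s - r) = 0"
      using isometry_inner[OF lin iso] s by (metis inner_diff_right right_minus_eq)
  qed
  then have r: "U (U r) = r" using s by simp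
  show thesis
  proof (rule that)
    \<comment> \<open>Since \<open>U (U r) = r\<close>, the even and odd parts of \<open>r\<close>
      under \<open>U\<close> are fixed and negated by \<open>U\<close>.\<close>
    show "f = (1/2) *\<^sub>R (r + U r) + (1/2) *\<^sub>R (r - U r) + w"
      by (simp add: r_def algebra_simps) (metis add.commute diff_add_cancel scaleR_half_double scaleR_add_right)
    show "U ((1/2) *\<^sub>R (r + U r)) = (1/2) *\<^sub>R (r + U r)"
      by (simp add: linear_scale[OF lin] linear_add[OF lin] r add.commute)
    show "U ((1/2) *\<^sub>R (r - U r)) = - ((1/2) *\<^sub>R (r - U r))"
      by (simp add: linear_scale[OF lin] linear_diff[OF lin] r scaleR_minus_right[symmetric] del: scaleR_minus_right)
    show "null_mean_square (\<lambda>n. inner e ((U ^^ n) w))" for e using w(1) by (simp add: W_def)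
  qed
qed

section \<open>Square-summable states\<close>

definition vinner :: "('d::finite \<times> bool \<Rightarrow> complex) \<Rightarrow> ('d \<times> bool \<Rightarrow> complex) \<Rightarrow> complex" where
  "vinner v w = (\<Sum>c\<in>UNIV. cnj (v c) * w c)"

lemma vnorm2_nonneg [simp]: "0 \<le> vnorm2 v"
  by (simp add: vnorm2_def sum_nonneg)

lemma vnorm2_0 [simp]: "vnorm2 (\<lambda>c. 0) = 0"
  by (simp add: vnorm2_def)

lemma component_le_vnorm2: "(cmod (v c))\<^sup>2 \<le> vnorm2 v"
  unfolding vnorm2_def by (rule member_le_sum) auto

lemma vnorm2_eq_0_iff: "vnorm2 v = 0 \<longleftrightarrow> v = (\<lambda>c. 0)"
  unfolding vnorm2_def by (subst sum_nonneg_eq_0_iff) auto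

lemma vnorm2_scale: "vnorm2 (\<lambda>c. k * v c) = (cmod k)\<^sup>2 * vnorm2 v"
  by (simp add: vnorm2_def norm_mult power_mult_distrib sum_distrib_left)

lemma vnorm2_add_le: "vnorm2 (\<lambda>c. v c + w c) \<le> 2 * vnorm2 v + 2 * vnorm2 w"
proof -
  have "(cmod (v c + w c))\<^sup>2 \<le> 2 * (cmod (v c))\<^sup>2 + 2 * (cmod (w c))\<^sup>2" for c
    by (rule norm_add_square_le)
  then show ?thesis
    unfolding vnorm2_def sum_distrib_left sum.distrib[symmetric] by (intro sum_mono)
qed

lemma vinner_self: "vinner v v = of_real (vnorm2 v)"
  by (simp add: vinner_def vnorm2_def mult.commute complex_norm_square[symmetric] del: of_real_power)

lemma norm_vinner_le: "norm (vinner v w) \<le> vnorm2 v + vnorm2 w"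
proof -
  have "norm (vinner v w) \<le> (\<Sum>c\<in>UNIV. (cmod (v c))\<^sup>2 + (cmod (w c))\<^sup>2)"
    unfolding vinner_def
  proof (rule sum_norm_le)
    fix c
    show "norm (cnj (v c) * w c) \<le> (cmod (v c))\<^sup>2 + (cmod (w c))\<^sup>2"
      using sum_squares_bound[of "cmod (v c)" "cmod (w c)"]
        mult_nonneg_nonneg[OF norm_ge_zero[of "v c"] norm_ge_zero[of "w c"]]
      unfolding norm_mult complex_mod_cnj by linarith
  qed
  then show ?thesis by (simp add: vnorm2_def sum.distrib)
qed

lemma ell2_inner_vinner: "ell2_inner f g = (\<Sum>\<^sub>\<infinity>x. vinner (f x) (g x))"
  by (simp add: ell2_inner_def vinner_def)

lemma vinner_summable:
  assumes "in_ell2 f" "in_ell2 g"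
  shows "(\<lambda>x. vinner (f x) (g x)) summable_on UNIV"
proof (rule abs_summable_summable)
  show "(\<lambda>x. norm (vinner (f x) (g x))) summable_on UNIV"
    by (rule summable_on_comparison_test[OF summable_on_add[OF assms[unfolded in_ell2_def]]])
       (auto intro: norm_vinner_le)
qed

lemma in_ell2_0 [simp]: "in_ell2 (\<lambda>x c. 0)"
  by (simp add: in_ell2_def)

lemma in_ell2_comparison:
  assumes "in_ell2 f" "\<And>x. vnorm2 (g x) \<le> C * vnorm2 (f x)"
  shows "in_ell2 g"
  unfolding in_ell2_def
  by (rule summable_on_comparison_test[OF summable_on_cmult_right[OF assms(1)[unfolded in_ell2_def], of C]])
     (use assms(2) in auto)

lemma in_ell2_scale: "in_ell2 f \<Longrightarrow> in_ell2 (\<lambda>x c. k * f x c)"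
  by (rule in_ell2_comparison[of f _ "(cmod k)\<^sup>2"]) (auto simp: vnorm2_scale)

lemma in_ell2_add:
  assumes "in_ell2 f" "in_ell2 g"
  shows "in_ell2 (\<lambda>x c. f x c + g x c)"
  unfolding in_ell2_def
proof (rule summable_on_comparison_test)
  show "(\<lambda>x. 2 * vnorm2 (f x) + 2 * vnorm2 (g x)) summable_on UNIV"
    using assms unfolding in_ell2_def by (intro summable_on_add summable_on_cmult_right)
qed (auto intro: vnorm2_add_le)

lemma in_ell2_diff:
  assumes "in_ell2 f" "in_ell2 g"
  shows "in_ell2 (\<lambda>x c. f x c - g x c)"
  using in_ell2_add[OF assms(1) in_ell2_scale[OF assms(2), of "-1"]] by simp

lemma ell2_inner_add_right:
  assumes "in_ell2 h" "in_ell2 f" "in_ell2 g"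
  shows "ell2_inner h (\<lambda>x c. f x c + g x c) = ell2_inner h f + ell2_inner h g"
proof -
  have "vinner (h x) (\<lambda>c. f x c + g x c) = vinner (h x) (f x) + vinner (h x) (g x)" for x
    by (simp add: vinner_def sum.distrib algebra_simps)
  then show ?thesis
    using infsum_add[OF vinner_summable[OF assms(1,2)] vinner_summable[OF assms(1,3)]]
    by (simp add: ell2_inner_vinner)
qed

lemma ell2_inner_scale_left: "ell2_inner (\<lambda>x c. k * h x c) f = cnj k * ell2_inner h f"
proof -
  have "vinner (\<lambda>c. k * h x c) (f x) = cnj k * vinner (h x) (f x)" for x
    by (simp add: vinner_def sum_distrib_left algebra_simps)
  then show ?thesis by (simp add: ell2_inner_vinner infsum_cmult_right')
qed

lemma ell2_inner_cnj: "ell2_inner g f = cnj (ell2_inner f g)"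
proof -
  have "vinner (g x) (f x) = cnj (vinner (f x) (g x))" for x
    by (simp add: vinner_def mult.commute)
  then show ?thesis by (simp add: ell2_inner_vinner infsum_cnj)
qed

lemma ell2_inner_self:
  assumes "in_ell2 f"
  shows "ell2_inner f f = of_real (\<Sum>\<^sub>\<infinity>x. vnorm2 (f x))"
  unfolding ell2_inner_vinner vinner_self
  by (rule infsumI[OF has_sum_of_real[OF has_sum_infsum]]) (use assms in \<open>simp add: in_ell2_def\<close>)

lemma vnorm2_le_infsum:
  assumes "in_ell2 f"
  shows "vnorm2 (f x) \<le> (\<Sum>\<^sub>\<infinity>x. vnorm2 (f x))"
  using finite_sum_le_infsum[of "\<lambda>x. vnorm2 (f x)" UNIV "{x}"] assms by (simp add: in_ell2_def)

section \<open>The Hilbert space of states\<close>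

typedef (overloaded) 'd walk_state = "{f :: ('d::finite \<Rightarrow> int) \<Rightarrow> ('d \<times> bool \<Rightarrow> complex). in_ell2 f}"
  morphisms amp state
  by (rule exI[of _ "\<lambda>x c. 0"]) simp

lemma in_ell2_amp [simp]: "in_ell2 (amp f)"
  using amp[of f] by simp

lemma amp_state [simp]: "in_ell2 f \<Longrightarrow> amp (state f) = f"
  by (simp add: state_inverse)

lemma walk_state_eqI: "(\<And>x c. amp f x c = amp g x c) \<Longrightarrow> f = g"
  by (metis amp_inject ext)

instantiation walk_state :: (finite) real_vector
begin

definition "0 = state (\<lambda>x c. 0)"
definition "f + g = state (\<lambda>x c. amp f x c + amp g x c)"
definition "f - g = state (\<lambda>x c. amp f x c - amp g x c)"
definition "- f = state (\<lambda>x c. - amp f x c)" for f :: "'a walk_state"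
definition "r *\<^sub>R f = state (\<lambda>x c. of_real r * amp f x c)" for f :: "'a walk_state"

lemma amp_zero [simp]: "amp 0 = (\<lambda>x c. 0)"
  by (simp add: zero_walk_state_def)

lemma amp_add [simp]: "amp (f + g) = (\<lambda>x c. amp f x c + amp g x c)"
  by (simp add: plus_walk_state_def in_ell2_add)

lemma amp_diff [simp]: "amp (f - g) = (\<lambda>x c. amp f x c - amp g x c)"
  by (simp add: minus_walk_state_def in_ell2_diff)

lemma amp_uminus [simp]: "amp (- f) = (\<lambda>x c. - amp f x c)"
  using in_ell2_scale[of "amp f" "-1"] by (simp add: uminus_walk_state_def)

lemma amp_scaleR [simp]: "amp (r *\<^sub>R f) = (\<lambda>x c. of_real r * amp f x c)"
  by (simp add: scaleR_walk_state_def in_ell2_scale)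

instance
  by standard (rule walk_state_eqI; simp add: algebra_simps)+

end

instantiation walk_state :: (finite) real_inner
begin

text \<open>A real Hilbert space structure suffices: imaginary parts of \<open>ell2_inner\<close>
  are recovered by multiplying one argument by \<i>.\<close>

definition "inner f g = Re (ell2_inner (amp f) (amp g))"
definition "norm f = sqrt (inner f f)" for f :: "'a walk_state"
definition "sgn f = f /\<^sub>R norm f" for f :: "'a walk_state"
definition "dist f g = norm (f - g)" for f :: "'a walk_state"
definition "uniformity = (INF e\<in>{0 <..}. principal {(f, g :: 'a walk_state). dist f g < e})"
definition "open S = (\<forall>f\<in>S. \<forall>\<^sub>F (f', g) in uniformity. f' = f \<longrightarrow> g \<in> S)" for S :: "'a walk_state set"

instance
proof
  fix f g h :: "'a walk_state" and r s :: real
  have comm: "inner f g = inner g f" for f g :: "'a walk_state"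
    unfolding inner_walk_state_def by (subst ell2_inner_cnj) simp
  show "inner f g = inner g f" by (rule comm)
  show "inner (f + g) h = inner f h + inner g h"
    by (simp only: comm[of _ h]) (simp add: inner_walk_state_def ell2_inner_add_right)
  show "inner (r *\<^sub>R f) g = r * inner f g"
    by (simp add: inner_walk_state_def ell2_inner_scale_left)
  show "0 \<le> inner f f"
    by (simp add: inner_walk_state_def ell2_inner_self infsum_nonneg)
  show "inner f f = 0 \<longleftrightarrow> f = 0"
  proof
    assume "inner f f = 0"
    then have "vnorm2 (amp f x) \<le> 0" for x
      using vnorm2_le_infsum[of "amp f" x] by (simp add: inner_walk_state_def ell2_inner_self)
    then have "amp f x = (\<lambda>c. 0)" for x
      using vnorm2_nonneg[of "amp f x"] by (metis order.antisym vnorm2_eq_0_iff)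
    then show "f = 0" by (intro walk_state_eqI) simp
  qed (simp add: inner_walk_state_def ell2_inner_self)
qed (rule norm_walk_state_def sgn_walk_state_def dist_walk_state_def
    uniformity_walk_state_def open_walk_state_def)+

end

lemma norm_walk_state_square: "(norm f)\<^sup>2 = (\<Sum>\<^sub>\<infinity>x. vnorm2 (amp f x))"
  by (simp add: power2_norm_eq_inner inner_walk_state_def ell2_inner_self)

lemma vnorm2_le_norm: "vnorm2 (amp f x) \<le> (norm f)\<^sup>2"
  by (simp add: norm_walk_state_square vnorm2_le_infsum)

lemma amp_le_norm: "cmod (amp f x c) \<le> norm f"
  by (rule power2_le_imp_le[OF order.trans[OF component_le_vnorm2 vnorm2_le_norm]]) simp

text \<open>Amplitudes converge pointwise; the Cauchy bound is passed to the limit on finite sets of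
  sites and only then summed over the lattice.\<close>

instance walk_state :: (finite) complete_space
proof
  fix X :: "nat \<Rightarrow> 'a walk_state"
  assume X: "Cauchy X"
  have "convergent (\<lambda>n. amp (X n) x c)" for x c
  proof (rule Cauchy_convergent, rule metric_CauchyI)
    fix e :: real assume "0 < e"
    then obtain M where "\<forall>m\<ge>M. \<forall>n\<ge>M. dist (X m) (X n) < e" using metric_CauchyD[OF X] by blast
    then show "\<exists>M. \<forall>m\<ge>M. \<forall>n\<ge>M. dist (amp (X m) x c) (amp (X n) x c) < e"
      using amp_le_norm[of "X _ - X _" x c] unfolding dist_norm
      by (metis amp_diff order.strict_trans1)
  qed
  then obtain L where L: "\<And>x c. (\<lambda>n. amp (X n) x c) \<longlonglongrightarrow> L x c"
    unfolding convergent_def by metis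
  have close: "\<exists>M. \<forall>n\<ge>M. in_ell2 (\<lambda>x c. amp (X n) x c - L x c) \<and> (\<Sum>\<^sub>\<infinity>x. vnorm2 (\<lambda>c. amp (X n) x c - L x c)) \<le> e\<^sup>2"
    if e: "0 < e" for e
  proof -
    obtain M where M: "\<And>m n. m \<ge> M \<Longrightarrow> n \<ge> M \<Longrightarrow> dist (X m) (X n) < e"
      using metric_CauchyD[OF X e] by blast
    \<comment> \<open>On a finite set \<open>F\<close> the limit in \<open>m\<close> commutes with
      the sum, and the bound does not depend on \<open>F\<close>.\<close>
    have fin: "(\<Sum>x\<in>F. vnorm2 (\<lambda>c. amp (X n) x c - L x c)) \<le> e\<^sup>2" if "finite F" "n \<ge> M" for F n
    proof (rule LIMSEQ_le_const2)
      show "(\<lambda>m. \<Sum>x\<in>F. vnorm2 (\<lambda>c. amp (X n) x c - amp (X m) x c)) \<longlonglongrightarrow> (\<Sum>x\<in>F. vnorm2 (\<lambda>c. amp (X n) x c - L x c))"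
        unfolding vnorm2_def by (intro tendsto_intros L)
      have "(\<Sum>x\<in>F. vnorm2 (\<lambda>c. amp (X n) x c - amp (X m) x c)) \<le> e\<^sup>2" if "m \<ge> M" for m
      proof -
        have "(\<Sum>x\<in>F. vnorm2 (amp (X n - X m) x)) \<le> (norm (X n - X m))\<^sup>2"
          unfolding norm_walk_state_square
          by (rule finite_sum_le_infsum)
             (use \<open>finite F\<close> in_ell2_amp[of "X n - X m"] in \<open>auto simp: in_ell2_def\<close>)
        also have "\<dots> \<le> e\<^sup>2"
          using M[OF \<open>n \<ge> M\<close> that] by (intro power_mono) (auto simp: dist_norm)
        finally show ?thesis by simp
      qed
      then show "\<exists>N. \<forall>m\<ge>N. (\<Sum>x\<in>F. vnorm2 (\<lambda>c. amp (X n) x c - amp (X m) x c)) \<le> e\<^sup>2" by blast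
    qed
    show ?thesis
    proof (intro exI allI impI conjI)
      fix n assume n: "n \<ge> M"
      show s: "in_ell2 (\<lambda>x c. amp (X n) x c - L x c)"
        unfolding in_ell2_def using fin[OF _ n]
        by (intro nonneg_bdd_above_summable_on) (auto intro!: bdd_aboveI[of _ "e\<^sup>2"])
      show "(\<Sum>\<^sub>\<infinity>x. vnorm2 (\<lambda>c. amp (X n) x c - L x c)) \<le> e\<^sup>2"
        by (rule infsum_le_finite_sums[OF s[unfolded in_ell2_def]]) (use fin[OF _ n] in auto)
    qed
  qed
  obtain n where "in_ell2 (\<lambda>x c. amp (X n) x c - L x c)" using close[of 1] by auto
  \<comment> \<open>\<open>L\<close> is the difference of \<open>X n\<close> and
    \<open>X n - L\<close>, both square-summable.\<close>
  then have "in_ell2 L"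
    using in_ell2_diff[OF in_ell2_amp[of "X n"], of "\<lambda>x c. amp (X n) x c - L x c"] by simp
  then have L': "amp (state L) = L" by simp
  have "X \<longlonglongrightarrow> state L"
  proof (rule metric_LIMSEQ_I)
    fix e :: real assume e: "0 < e"
    obtain M where M: "\<And>n. n \<ge> M \<Longrightarrow> (\<Sum>\<^sub>\<infinity>x. vnorm2 (\<lambda>c. amp (X n) x c - L x c)) \<le> (e / 2)\<^sup>2"
      using close[of "e / 2"] e by auto
    have "dist (X n) (state L) < e" if "n \<ge> M" for n
    proof -
      have "(norm (X n - state L))\<^sup>2 \<le> (e / 2)\<^sup>2"
        using M[OF that] by (simp add: norm_walk_state_square L')
      then have "norm (X n - state L) \<le> e / 2"
        by (rule power2_le_imp_le) (use e in auto)
      then show ?thesis using e by (simp add: dist_norm)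
    qed
    then show "\<exists>M. \<forall>n\<ge>M. dist (X n) (state L) < e" by blast
  qed
  then show "convergent X" by (auto simp: convergent_def)
qed

definition delta_at :: "('d::finite \<Rightarrow> int) \<Rightarrow> ('d \<times> bool \<Rightarrow> complex) \<Rightarrow> ('d \<Rightarrow> int) \<Rightarrow> 'd \<times> bool \<Rightarrow> complex" where
  "delta_at y \<phi> = (\<lambda>x c. if x = y then \<phi> c else 0)"

lemma delta0_eq: "delta0 \<phi> = delta_at (\<lambda>i. 0) \<phi>"
  by (auto simp: delta0_def delta_at_def)

lemma in_ell2_finite_support:
  assumes "finite S" "\<And>x. x \<notin> S \<Longrightarrow> f x = (\<lambda>c. 0)"
  shows "in_ell2 f"
  unfolding in_ell2_def
  by (rule summable_on_cong_neutral[THEN iffD1, OF _ _ _ summable_on_finite[OF assms(1)]])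
     (use assms(2) in auto)

lemma in_ell2_delta [simp]: "in_ell2 (delta_at y \<phi>)"
  by (rule in_ell2_finite_support[of "{y}"]) (auto simp: delta_at_def)

lemma ell2_inner_delta: "ell2_inner (delta_at y \<phi>) f = vinner \<phi> (f y)"
proof -
  have "ell2_inner (delta_at y \<phi>) f = (\<Sum>\<^sub>\<infinity>x\<in>{y}. vinner (delta_at y \<phi> x) (f x))"
    unfolding ell2_inner_vinner
    by (rule infsum_cong_neutral) (auto simp: delta_at_def vinner_def)
  then show ?thesis by (simp add: delta_at_def vinner_def)
qed

text \<open>Taking \<open>k = 1\<close> and \<open>k = \<i>\<close> reads off the real and imaginary
  part of an amplitude, so real inner products with point masses determine a state.\<close>

lemma inner_delta: "inner (state (delta_at y (\<lambda>b. if b = c then k else 0))) f = Re (cnj k * amp f y c)"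
proof -
  have "vinner (\<lambda>b. if b = c then k else 0) (amp f y) = (\<Sum>b\<in>UNIV. if b = c then cnj k * amp f y c else 0)"
    unfolding vinner_def by (rule sum.cong) auto
  then show ?thesis by (simp add: inner_walk_state_def ell2_inner_delta)
qed

lemma has_sum_finite_sum:
  fixes f :: "'c \<Rightarrow> 'a \<Rightarrow> 'b::{topological_comm_monoid_add}"
  assumes "finite C" "\<And>c. c \<in> C \<Longrightarrow> (f c has_sum s c) A"
  shows "((\<lambda>x. \<Sum>c\<in>C. f c x) has_sum (\<Sum>c\<in>C. s c)) A"
  using assms by (induction C rule: finite_induct) (auto intro: has_sum_add)

text \<open>Each component has its own bijection because the walk shifts each component in its own
  direction.\<close>

lemma in_ell2_permute:
  assumes f: "in_ell2 f" and s: "\<And>c. bij (s c)"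
  shows "in_ell2 (\<lambda>x c. f (s c x) c)" (is ?A)
    and "(\<Sum>\<^sub>\<infinity>x. vnorm2 (\<lambda>c. f (s c x) c)) = (\<Sum>\<^sub>\<infinity>x. vnorm2 (f x))" (is ?B)
proof -
  have comp: "(\<lambda>x. (cmod (f x c))\<^sup>2) summable_on UNIV" for c
    by (rule summable_on_comparison_test[OF f[unfolded in_ell2_def]]) (auto simp: component_le_vnorm2)
  have sh: "((\<lambda>x. (cmod (f (s c x) c))\<^sup>2) has_sum (\<Sum>\<^sub>\<infinity>x. (cmod (f x c))\<^sup>2)) UNIV" for c
    using has_sum_reindex_bij_betw[OF s[of c], of "\<lambda>x. (cmod (f x c))\<^sup>2"] has_sum_infsum[OF comp] by blast
  have 1: "((\<lambda>x. \<Sum>c\<in>UNIV. (cmod (f (s c x) c))\<^sup>2) has_sum (\<Sum>c\<in>UNIV. \<Sum>\<^sub>\<infinity>x. (cmod (f x c))\<^sup>2)) UNIV"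
    by (rule has_sum_finite_sum) (use sh in auto)
  have 2: "((\<lambda>x. \<Sum>c\<in>UNIV. (cmod (f x c))\<^sup>2) has_sum (\<Sum>c\<in>UNIV. \<Sum>\<^sub>\<infinity>x. (cmod (f x c))\<^sup>2)) UNIV"
    by (rule has_sum_finite_sum) (use has_sum_infsum[OF comp] in auto)
  show ?A unfolding in_ell2_def vnorm2_def using 1 by (auto simp: summable_on_def)
  show ?B unfolding vnorm2_def using infsumI[OF 1] infsumI[OF 2] by simp
qed

section \<open>The Grover coin and the walk operator\<close>

lemma grover_eq: "grover v c = (\<Sum>b\<in>UNIV. v b) / of_nat CARD('d) - v c"
  for v :: "'d::finite \<times> bool \<Rightarrow> complex"
  by (simp add: grover_def card_cartesian_product)

text \<open>The Grover matrix is the reflection \<open>2 Q - I\<close>, with \<open>Q\<close> the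
  orthogonal projection onto constant vectors.\<close>

lemma vnorm2_grover: "vnorm2 (grover v) = vnorm2 v" for v :: "'d::finite \<times> bool \<Rightarrow> complex"
proof -
  define S where "S = (\<Sum>b\<in>UNIV. v b)"
  define t where "t = S / of_nat CARD('d)"
  have tS: "of_nat CARD('d) * t = S" by (simp add: t_def)
  have "of_real (vnorm2 (grover v)) = (\<Sum>c\<in>UNIV. (t - v c) * cnj (t - v c))"
    unfolding complex_norm_square[symmetric]
    by (simp add: vnorm2_def grover_eq t_def S_def)
  also have "\<dots> = (\<Sum>c\<in>UNIV. t * cnj t - t * cnj (v c) - cnj t * v c + v c * cnj (v c))"
    by (rule sum.cong) (auto simp: algebra_simps)
  also have "\<dots> = 2 * of_nat CARD('d) * (t * cnj t) - t * cnj S - cnj t * S + (\<Sum>c\<in>UNIV. v c * cnj (v c))"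
    by (simp add: sum.distrib sum_subtractf sum_distrib_left[symmetric] S_def card_cartesian_product)
  \<comment> \<open>With \<open>S = d t\<close> the two cross terms each subtract \<open>d\<close>
    times \<open>t * cnj t\<close>, exactly the contribution of the 2d copies of
    \<open>t\<close>.\<close>
  also have "\<dots> = (\<Sum>c\<in>UNIV. v c * cnj (v c))"
    by (simp add: tS[symmetric])
  also have "\<dots> = of_real (vnorm2 v)"
    unfolding complex_norm_square[symmetric] by (simp add: vnorm2_def)
  finally show ?thesis by (simp only: of_real_eq_iff)
qed

lemma grover_grover: "grover (grover v) = v" for v :: "'d::finite \<times> bool \<Rightarrow> complex"
  by (rule ext) (simp add: grover_eq[abs_def] sum_subtractf card_cartesian_product)

lemma grover_linear:
  "grover (\<lambda>b. v b + w b) c = grover v c + grover w c"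
  "grover (\<lambda>b. k * v b) c = k * grover v c"
  by (simp_all add: grover_eq sum.distrib sum_distrib_left[symmetric] add_divide_distrib algebra_simps)

lemma bij_shift: "bij (\<lambda>x i. x i - a i :: int)" "bij (\<lambda>x i. x i + a i :: int)"
  by (rule o_bij[of "\<lambda>x i. x i + a i"]; auto simp: comp_def)
     (rule o_bij[of "\<lambda>x i. x i - a i"]; auto simp: comp_def)

lemma in_ell2_grover:
  assumes "in_ell2 f"
  shows "in_ell2 (\<lambda>x. grover (f x))"
  using assms by (simp add: in_ell2_def vnorm2_grover)

lemma U_std_ell2:
  assumes "in_ell2 f"
  shows "in_ell2 (U_std f)" "(\<Sum>\<^sub>\<infinity>x. vnorm2 (U_std f x)) = (\<Sum>\<^sub>\<infinity>x. vnorm2 (f x))"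
  using in_ell2_permute[OF in_ell2_grover[OF assms] bij_shift(1)[of "std_dir _"]]
  by (simp_all add: U_std_def[abs_def] vnorm2_grover)

definition walk_op :: "'d::finite walk_state \<Rightarrow> 'd walk_state" where
  "walk_op f = state (U_std (amp f))"

lemma amp_walk_op [simp]: "amp (walk_op f) = U_std (amp f)"
  by (simp add: walk_op_def U_std_ell2)

lemma amp_walk_op_funpow: "amp ((walk_op ^^ n) f) = (U_std ^^ n) (amp f)"
  by (induction n) auto

lemma linear_walk_op: "linear walk_op"
  by (rule linearI; rule walk_state_eqI; simp add: U_std_def grover_linear)

lemma norm_walk_op: "norm (walk_op f) = norm f"
proof -
  have "(norm (walk_op f))\<^sup>2 = (norm f)\<^sup>2" by (simp add: norm_walk_state_square U_std_ell2)
  then show ?thesis by simp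
qed

text \<open>The preimage undoes the shifts first and then applies the coin, which is its own
  inverse.\<close>

lemma surj_walk_op: "surj walk_op"
proof (rule surjI)
  fix f :: "'d::finite walk_state"
  define g where "g = (\<lambda>x. grover (\<lambda>c. amp f (\<lambda>i. x i + std_dir c i) c))"
  have g: "in_ell2 g" unfolding g_def
    by (intro in_ell2_grover in_ell2_permute(1)[where s = "\<lambda>c x i. x i + std_dir c i"] bij_shift) simp
  show "walk_op (state (\<lambda>x. grover (\<lambda>c. amp f (\<lambda>i. x i + std_dir c i) c))) = f"
    by (rule walk_state_eqI)
       (simp add: g[unfolded g_def] U_std_def grover_grover)
qed

section \<open>Linear recurrences\<close>

text \<open>The polynomial \<open>p\<close> in the shift \<tau>, applied to the sequence
  \<open>a\<close>. Linear recurrences become annihilation by \<open>p\<close>, and factoring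
  \<open>p\<close> factors the recurrence.\<close>

definition shift_poly :: "complex poly \<Rightarrow> (nat \<Rightarrow> complex) \<Rightarrow> nat \<Rightarrow> complex" where
  "shift_poly p a n = (\<Sum>i\<le>degree p. coeff p i * a (n + i))"

lemma shift_poly_extend: "degree p \<le> m \<Longrightarrow> shift_poly p a n = (\<Sum>i\<le>m. coeff p i * a (n + i))"
  unfolding shift_poly_def by (rule sum.mono_neutral_left) (auto simp: coeff_eq_0)

lemma shift_poly_0 [simp]: "shift_poly 0 a n = 0"
  by (simp add: shift_poly_def)

lemma shift_poly_const [simp]: "shift_poly [:c:] a n = c * a n"
  by (simp add: shift_poly_def)

lemma shift_poly_pCons: "shift_poly (pCons c p) a n = c * a n + shift_poly p a (Suc n)"
proof -
  have "shift_poly (pCons c p) a n = (\<Sum>i\<le>Suc (degree p). coeff (pCons c p) i * a (n + i))"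
    by (rule shift_poly_extend) (rule degree_pCons_le)
  then show ?thesis by (subst (asm) sum.atMost_Suc_shift) (simp add: shift_poly_def)
qed

lemma shift_poly_add: "shift_poly (p + q) a n = shift_poly p a n + shift_poly q a n"
  using shift_poly_extend[of p "max (degree p) (degree q)" a n]
    shift_poly_extend[of q "max (degree p) (degree q)" a n]
    shift_poly_extend[of "p + q" "max (degree p) (degree q)" a n]
  by (simp add: degree_add_le sum.distrib algebra_simps)

lemma shift_poly_sum: "shift_poly (\<Sum>i\<in>I. p i) a n = (\<Sum>i\<in>I. shift_poly (p i) a n)"
  by (induction I rule: infinite_finite_induct) (auto simp: shift_poly_add)

lemma shift_poly_smult: "shift_poly (smult c p) a n = c * shift_poly p a n"
  using shift_poly_extend[of "smult c p" "degree p" a n]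
  by (simp add: shift_poly_def sum_distrib_left mult.assoc degree_smult_le)

lemma shift_poly_mult: "shift_poly (p * q) a n = shift_poly p (shift_poly q a) n"
proof (induction p arbitrary: n)
  case (pCons c p)
  then show ?case
    by (simp add: shift_poly_add shift_poly_smult shift_poly_pCons mult_pCons_left)
qed simp

lemma shift_poly_commute: "shift_poly p (shift_poly q a) n = shift_poly q (shift_poly p a) n"
  by (metis shift_poly_mult mult.commute)

lemma shift_poly_seq_zero [simp]: "shift_poly p (\<lambda>n. 0) n = 0"
  by (simp add: shift_poly_def)

lemma shift_poly_seq_add: "shift_poly p (\<lambda>n. a n + b n) n = shift_poly p a n + shift_poly p b n"
  by (simp add: shift_poly_def sum.distrib algebra_simps)

lemma shift_poly_seq_diff: "shift_poly p (\<lambda>n. a n - b n) n = shift_poly p a n - shift_poly p b n"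
  by (simp add: shift_poly_def sum_subtractf algebra_simps)

lemma shift_poly_seq_sum: "shift_poly p (\<lambda>n. \<Sum>i\<in>I. a i n) n = (\<Sum>i\<in>I. shift_poly p (a i) n)"
  by (induction I rule: infinite_finite_induct) (auto simp: shift_poly_seq_add)

lemma shift_poly_shift: "shift_poly p (\<lambda>n. a (Suc n)) n = shift_poly p a (Suc n)"
  by (simp add: shift_poly_def)

lemma shift_poly_bounded:
  assumes "\<And>n. norm (a n) \<le> C"
  shows "\<exists>C'. \<forall>n. norm (shift_poly p a n) \<le> C'"
proof (intro exI allI)
  fix n
  show "norm (shift_poly p a n) \<le> (\<Sum>i\<le>degree p. norm (coeff p i) * C)"
    unfolding shift_poly_def
    by (intro sum_norm_le) (auto simp: norm_mult intro: mult_left_mono assms)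
qed

lemma mean_telescope:
  fixes a :: "nat \<Rightarrow> complex"
  assumes "\<And>n. norm (a n) \<le> C"
  shows "(\<lambda>N. (1 / of_nat N) * (\<Sum>n=1..N. a n - a (Suc n))) \<longlonglongrightarrow> 0"
proof (rule Lim_null_comparison)
  show "\<forall>\<^sub>F N in sequentially. norm ((1 / of_nat N) * (\<Sum>n=1..N. a n - a (Suc n))) \<le> (2 * C) / real N"
  proof (intro always_eventually allI)
    fix N
    have "(\<Sum>n=1..N. a n - a (Suc n)) = a 1 - a (Suc N)"
      by (induction N) auto
    moreover have "norm (a 1 - a (Suc N)) \<le> 2 * C"
      using norm_triangle_ineq4[of "a 1" "a (Suc N)"] assms[of 1] assms[of "Suc N"] by simp
    ultimately show "norm ((1 / of_nat N) * (\<Sum>n=1..N. a n - a (Suc n))) \<le> (2 * C) / real N"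
      by (simp add: norm_divide divide_right_mono del: One_nat_def)
  qed
qed (rule lim_const_over_n)

text \<open>Induction removes one root \<open>z\<close> of \<open>p\<close> at a time:
  \<open>a'\<close> satisfies the recurrence of the cofactor \<open>q\<close>. Summation by parts
  transfers the change to \<open>c\<close>, which is replaced by a shifted \<open>c'\<close> obeying
  the recurrence of \<open>r\<close> as well. Multiple roots need no separate treatment; boundedness
  controls the boundary terms.\<close>

lemma coprime_recurrences_mean:
  fixes a c :: "nat \<Rightarrow> complex"
  assumes "p \<noteq> 0" and "\<And>n. shift_poly p a n = 0" and "\<And>n. shift_poly r c n = 0"
    and "\<And>n. norm (a n) \<le> A" and "\<And>n. norm (c n) \<le> C"
    and "\<And>z. poly p z = 0 \<Longrightarrow> z \<noteq> 0 \<Longrightarrow> poly r (1 / z) \<noteq> 0"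
  shows "(\<lambda>N. (1 / of_nat N) * (\<Sum>n=1..N. a n * c n)) \<longlonglongrightarrow> 0"
  using assms
proof (induction "degree p" arbitrary: p a c A C)
  case 0
  then obtain k where "p = [:k:]" by (metis degree_eq_zeroE)
  with 0 have "a n = 0" for n by simp
  then show ?case by simp
next
  case (Suc m)
  obtain z where z: "poly p z = 0"
    using fundamental_theorem_of_algebra[of p] Suc.hyps(2) by (metis constant_degree Zero_not_Suc)
  then obtain q where q: "p = [:-z, 1:] * q" by (auto simp: poly_eq_0_iff_dvd elim: dvdE)
  define a' where "a' n = a (Suc n) - z * a n" for n
  have a'_eq: "a' = shift_poly [:-z, 1:] a"
    by (rule ext) (simp add: a'_def shift_poly_pCons)
  txt \<open>Since the shift has no eigenvalue $1/z$ on the solutions of the recurrence for \<open>c\<close>,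
    the sequence \<open>c\<close> is in the image of $1 - z\tau$.\<close>
  obtain c' s where c': "\<And>n. c n = c' n - z * c' (Suc n)" and c'_eq: "\<And>n. c' n = shift_poly s c n"
  proof (cases "z = 0")
    case True
    show ?thesis by (rule that[of c 1]) (auto simp: True shift_poly_def)
  next
    case False
    define k where "k = poly r (1 / z)"
    have k: "k \<noteq> 0" unfolding k_def by (rule Suc.prems(6)[OF z False])
    have "[:- (1 / z), 1:] dvd r - [:k:]"
      unfolding poly_eq_0_iff_dvd[symmetric] by (simp add: k_def)
    then obtain t where t: "r - [:k:] = [:- (1 / z), 1:] * t" by (rule dvdE)
    \<comment> \<open>Dividing \<open>r\<close> by \<open>X - 1/z\<close> leaves the remainder
      \<open>k\<close>, which is nonzero. Applied to \<open>c\<close>, with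
      \<open>d = shift_poly t c\<close>, this reads \<open>d(n+1) - d(n)/z + k c(n) = 0\<close>, so
      \<open>c' = d / (k z)\<close> is the required preimage.\<close>
    have r: "r = [:- (1 / z), 1:] * t + [:k:]" using t by (simp add: algebra_simps)
    have eq: "- (1 / z) * shift_poly t c n + shift_poly t c (Suc n) + k * c n = 0" for n
      using Suc.prems(3)[of n] by (subst (asm) r) (simp only: shift_poly_add shift_poly_mult shift_poly_pCons shift_poly_0 shift_poly_const; simp)
    show ?thesis
    proof (rule that[of "\<lambda>n. shift_poly (smult (1 / (k * z)) t) c n" "smult (1 / (k * z)) t"])
      fix n
      show "c n = shift_poly (smult (1 / (k * z)) t) c n - z * shift_poly (smult (1 / (k * z)) t) c (Suc n)"
        using eq[of n] k False by (simp add: shift_poly_smult field_simps)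
    qed simp
  qed
  have c'_ext: "c' = shift_poly s c" using c'_eq by auto
  obtain C' where C': "\<And>n. norm (c' n) \<le> C'"
    using shift_poly_bounded[of c C s] Suc.prems(5) c'_eq by auto
  obtain A' where A': "\<And>n. norm (a' n) \<le> A'"
    using shift_poly_bounded[of a A "[:-z, 1:]"] Suc.prems(4) a'_eq by auto
  have "(\<lambda>N. (1 / of_nat N) * (\<Sum>n=1..N. a' n * c' (Suc n))) \<longlonglongrightarrow> 0"
  proof (rule Suc.hyps(1))
    show q0: "q \<noteq> 0" using Suc.prems(1) q by auto
    have "degree p = degree [:-z, 1:] + degree q"
      unfolding q by (rule degree_mult_eq) (use q0 in auto)
    then show "m = degree q" using Suc.hyps(2) by simp
    show "shift_poly q a' n = 0" for n
      using Suc.prems(2)[of n] unfolding a'_eq q by (metis shift_poly_mult mult.commute)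
    have "shift_poly r c' n = 0" for n
    proof -
      have "shift_poly r c = (\<lambda>n. 0)" using Suc.prems(3) by auto
      then show ?thesis unfolding c'_ext by (subst shift_poly_commute) simp
    qed
    then show "shift_poly r (\<lambda>n. c' (Suc n)) n = 0" for n by (simp add: shift_poly_shift)
    show "poly r (1 / w) \<noteq> 0" if "poly q w = 0" "w \<noteq> 0" for w
      using Suc.prems(6)[of w] that q by simp
  qed (use A' C' in auto)
  moreover have "(\<lambda>N. (1 / of_nat N) * (\<Sum>n=1..N. a n * c' n - a (Suc n) * c' (Suc n))) \<longlonglongrightarrow> 0"
  proof (rule mean_telescope)
    show "norm (a n * c' n) \<le> A * C'" for n
      unfolding norm_mult using Suc.prems(4)[of n] C'[of n]
      by (intro mult_mono) (auto intro: order.trans[OF norm_ge_zero])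
  qed
  ultimately have "(\<lambda>N. (1 / of_nat N) * (\<Sum>n=1..N. a n * c' n - a (Suc n) * c' (Suc n))
     + (1 / of_nat N) * (\<Sum>n=1..N. a' n * c' (Suc n))) \<longlonglongrightarrow> 0 + 0"
    by (intro tendsto_add)
  \<comment> \<open>Summation by parts: insert \<open>c n = c' n - z * c' (Suc n)\<close>, then add
    and subtract \<open>a (Suc n) * c' (Suc n)\<close>.\<close>
  moreover have "a n * c n = (a n * c' n - a (Suc n) * c' (Suc n)) + a' n * c' (Suc n)" for n
    unfolding a'_def c'[of n] by (simp add: algebra_simps)
  then have "(\<lambda>N. (1 / of_nat N) * (\<Sum>n=1..N. a n * c' n - a (Suc n) * c' (Suc n))
     + (1 / of_nat N) * (\<Sum>n=1..N. a' n * c' (Suc n))) = (\<lambda>N. (1 / of_nat N) * (\<Sum>n=1..N. a n * c n))"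
    by (simp add: sum.distrib distrib_left del: One_nat_def)
  ultimately show ?case by simp
qed

text \<open>\<open>\<zeta> c\<close> is the Fourier multiplier of the shift in direction \<open>c\<close>. A component of the
  Fourier transformed walk satisfies the recurrence $M_j(\tau) v(c) = (\zeta_c \tau + 1) g/d$ for
  $c = \pm u_j$, where \<open>g\<close> is the sum of the components.\<close>

definition pair_poly :: "('d \<times> bool \<Rightarrow> complex) \<Rightarrow> 'd \<Rightarrow> complex poly" where
  "pair_poly \<zeta> j = [:1, \<zeta> (j, True) + \<zeta> (j, False), 1:]"

text \<open>The numerator of the sum of all \<open>1 / M_j\<close>. The deviations
  \<open>w j\<close> in \<open>walk_recurrence\<close> satisfy
  \<open>M_j w_j = (1 - \<tau>^2) g\<close> and add up to 0, so clearing denominators shows that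
  this polynomial annihilates \<open>(1 - \<tau>^2) g\<close>.\<close>

definition walk_poly :: "('d::finite \<times> bool \<Rightarrow> complex) \<Rightarrow> complex poly" where
  "walk_poly \<zeta> = (\<Sum>j\<in>UNIV. \<Prod>i\<in>UNIV - {j}. pair_poly \<zeta> i)"

text \<open>The difference over two time steps supplies the factor \<open>\<tau>^2 - 1\<close>
  needed in front of \<open>g\<close>, and \<open>pair_poly\<close> expresses the single component
  \<open>c\<close> through \<open>g\<close> alone.\<close>

lemma walk_recurrence:
  fixes v :: "nat \<Rightarrow> 'd::finite \<times> bool \<Rightarrow> complex"
  assumes v: "\<And>n c. v (Suc n) c = \<zeta> c * ((\<Sum>b\<in>UNIV. v n b) / of_nat CARD('d) - v n c)"
    and \<zeta>: "\<And>j. \<zeta> (j, True) * \<zeta> (j, False) = 1"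
  shows "shift_poly (pair_poly \<zeta> (fst c) * walk_poly \<zeta>) (\<lambda>n. v (Suc (Suc n)) c - v n c) n = 0"
proof -
  define g where "g n = (\<Sum>b\<in>UNIV. v n b) / of_nat CARD('d)" for n
  define opp where "opp c = (fst c, \<not> snd c)" for c :: "'d \<times> bool"
  have z2: "\<zeta> c * \<zeta> (opp c) = 1" and M: "pair_poly \<zeta> (fst c) = [:1, \<zeta> c + \<zeta> (opp c), 1:]" for c
    using \<zeta>[of "fst c"] by (cases c; cases "snd c"; simp add: opp_def pair_poly_def ac_simps)+
  have v': "v (Suc n) c = \<zeta> c * (g n - v n c)" for n c by (simp add: v g_def)
  \<comment> \<open>The opposite phase undoes \<open>\<zeta> c\<close>:
    \<open>\<zeta> (opp c) * v (Suc n) c = g n - v n c\<close>, so all terms in \<open>v\<close>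
    cancel.\<close>
  have Mv: "shift_poly (pair_poly \<zeta> (fst c)) (\<lambda>n. v n c) n = shift_poly [:1, \<zeta> c:] g n" for c n
    using z2[of c] by (simp add: M shift_poly_pCons v') algebra
  \<comment> \<open>The pair sums have average \<open>g\<close> over the d coordinates, so these
    deviations add up to 0.\<close>
  define w where "w j n = v n (j, True) + v n (j, False) - g n" for j n
  have Mw: "shift_poly (pair_poly \<zeta> j) (w j) n = shift_poly [:1, 0, -1:] g n" for j n
    using Mv[of "(j, True)" n] Mv[of "(j, False)" n]
    unfolding w_def shift_poly_seq_diff shift_poly_seq_add
    by (simp add: pair_poly_def shift_poly_pCons algebra_simps)
  have w0: "(\<Sum>j\<in>UNIV. w j n) = 0" for n
  proof -
    have "(\<Sum>j\<in>UNIV. w j n) = (\<Sum>j\<in>UNIV. \<Sum>s\<in>UNIV. v n (j, s)) - of_nat CARD('d) * g n"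
      by (simp add: w_def sum_subtractf UNIV_bool add.commute)
    also have "(\<Sum>j\<in>UNIV. \<Sum>s\<in>UNIV. v n (j, s)) = (\<Sum>b\<in>UNIV. v n b)"
      by (simp add: sum.cartesian_product)
    finally show ?thesis by (simp add: g_def)
  qed
  have prod: "(\<Prod>i\<in>UNIV - {j}. pair_poly \<zeta> i) * pair_poly \<zeta> j = (\<Prod>i\<in>UNIV. pair_poly \<zeta> i)" for j :: 'd
    by (subst mult.commute) (rule prod.remove[symmetric], auto)
  have Qg: "shift_poly (walk_poly \<zeta>) (shift_poly [:1, 0, -1:] g) n = 0" for n
  proof -
    have "shift_poly (walk_poly \<zeta>) (shift_poly [:1, 0, -1:] g) n
       = (\<Sum>j\<in>UNIV. shift_poly (\<Prod>i\<in>UNIV - {j}. pair_poly \<zeta> i) (shift_poly (pair_poly \<zeta> j) (w j)) n)"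
    proof -
      have "shift_poly (pair_poly \<zeta> j) (w j) = shift_poly [:1, 0, -1:] g" for j
        by (rule ext) (rule Mw)
      then show ?thesis by (simp only: walk_poly_def shift_poly_sum)
    qed
    also have "\<dots> = (\<Sum>j\<in>UNIV. shift_poly (\<Prod>i\<in>UNIV. pair_poly \<zeta> i) (w j) n)"
      by (simp only: shift_poly_mult[symmetric] prod)
    also have "\<dots> = shift_poly (\<Prod>i\<in>UNIV. pair_poly \<zeta> i) (\<lambda>n. \<Sum>j\<in>UNIV. w j n) n"
      by (simp add: shift_poly_seq_sum)
    finally show ?thesis by (simp add: w0)
  qed
  \<comment> \<open>Polynomials in the shift commute, so the product can be reordered until
    \<open>walk_poly\<close> acts on \<open>(1 - \<tau>^2) g\<close>.\<close>
  have "(\<lambda>n. v (Suc (Suc n)) c - v n c) = shift_poly [:-1, 0, 1:] (\<lambda>n. v n c)"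
    by (rule ext) (simp add: shift_poly_pCons)
  then have "shift_poly (pair_poly \<zeta> (fst c) * walk_poly \<zeta>) (\<lambda>n. v (Suc (Suc n)) c - v n c) n
    = shift_poly (walk_poly \<zeta> * [:-1, 0, 1:]) (shift_poly (pair_poly \<zeta> (fst c)) (\<lambda>n. v n c)) n"
    by (simp only: shift_poly_mult[symmetric]) (simp only: ac_simps)
  also have "shift_poly (pair_poly \<zeta> (fst c)) (\<lambda>n. v n c) = shift_poly [:1, \<zeta> c:] g"
    by (rule ext) (rule Mv)
  also have "shift_poly (walk_poly \<zeta> * [:-1, 0, 1:]) (shift_poly [:1, \<zeta> c:] g) n
    = shift_poly (smult (-1) [:1, \<zeta> c:]) (shift_poly (walk_poly \<zeta>) (shift_poly [:1, 0, -1:] g)) n"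
  proof -
    have "walk_poly \<zeta> * [:-1, 0, 1:] * [:1, \<zeta> c:] = smult (-1) [:1, \<zeta> c:] * walk_poly \<zeta> * [:1, 0, -1:]"
      by (simp add: algebra_simps)
    then show ?thesis by (simp only: shift_poly_mult[symmetric] mult.assoc)
  qed
  also have "\<dots> = 0"
  proof -
    have "shift_poly (walk_poly \<zeta>) (shift_poly [:1, 0, -1:] g) = (\<lambda>n. 0)"
      by (rule ext) (rule Qg)
    then show ?thesis by (simp only: shift_poly_seq_zero)
  qed
  finally show ?thesis .
qed

section \<open>The walk in Fourier space\<close>

text \<open>A density on the whole line keeps the space equal to \<open>UNIV\<close>: momenta are
  total functions, and almost-everywhere statements pass over from \<open>lborel\<close>.\<close>

definition circle :: "real measure" where
  "circle = density lborel (indicator {0..1})"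

definition torus :: "('d::finite \<Rightarrow> real) measure" where
  "torus = PiM UNIV (\<lambda>_. circle)"

lemma space_circle [simp]: "space circle = UNIV"
  and sets_circle [measurable_cong, simp]: "sets circle = sets borel"
  by (simp_all add: circle_def)

lemma prob_space_circle: "prob_space circle"
  by (rule prob_spaceI) (simp add: circle_def emeasure_density)

lemma prob_space_torus: "prob_space torus"
  unfolding torus_def by (intro prob_space_PiM prob_space_circle)

lemma space_torus [simp]: "space torus = UNIV"
  by (simp add: torus_def space_PiM)

lemma measurable_torus_component [measurable]: "(\<lambda>k. k i) \<in> borel_measurable torus"
proof -
  have "(\<lambda>k. k i) \<in> measurable torus circle"
    unfolding torus_def by (rule measurable_component_singleton) simp
  then show ?thesis by (simp cong: measurable_cong_sets)
qed

lemma AE_circle: "(AE t in lborel. P t) \<Longrightarrow> (AE t in circle. P t)"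
  unfolding circle_def by (subst AE_density) auto

text \<open>Fubini in the coordinate \<open>j\<close>: the exceptional set meets every line in this
  direction in a null set.\<close>

lemma AE_torus_slice:
  fixes j :: "'d::finite"
  assumes meas: "Measurable.pred torus P" and slice: "\<And>k. AE t in lborel. P (k(j := t))"
  shows "AE k in torus. P k"
proof -
  interpret product_prob_space "\<lambda>_::'d. circle"
    by (intro product_prob_spaceI prob_space_circle)
  define N where "N = {k. \<not> P k}"
  have N: "N \<in> sets torus"
  proof -
    note [measurable] = meas
    have "{k \<in> space torus. \<not> P k} \<in> sets torus" by measurable
    then show ?thesis by (simp add: N_def)
  qed
  have ins: "insert j (UNIV - {j}) = UNIV" by auto
  have meas': "indicator N \<in> borel_measurable (PiM (insert j (UNIV - {j})) (\<lambda>_. circle))"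
    unfolding ins torus_def[symmetric] using N by (rule borel_measurable_indicator)
  have "emeasure torus N = (\<integral>\<^sup>+ k. indicator N k \<partial>torus)" using N by simp
  also have "\<dots> = (\<integral>\<^sup>+ k. (\<integral>\<^sup>+ t. indicator N (k(j := t)) \<partial>circle) \<partial>PiM (UNIV - {j}) (\<lambda>_. circle))"
    unfolding torus_def using product_nn_integral_insert[OF _ _ meas'] by (simp add: ins)
  also have "(\<lambda>k. \<integral>\<^sup>+ t. indicator N (k(j := t)) \<partial>circle) = (\<lambda>k. 0)"
  proof
    fix k
    have "(\<integral>\<^sup>+ t. indicator N (k(j := t)) \<partial>circle) = (\<integral>\<^sup>+ t. 0 \<partial>circle)"
      using AE_circle[OF slice[of k]] by (intro nn_integral_cong_AE) (auto simp: N_def)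
    then show "(\<integral>\<^sup>+ t. indicator N (k(j := t)) \<partial>circle) = 0" by simp
  qed
  finally have "N \<in> null_sets torus" using N by auto
  then have "AE k in torus. k \<notin> N" by (rule AE_not_in)
  then show ?thesis by (simp add: N_def)
qed

section \<open>Almost every momentum avoids a given root\<close>

lemma AE_cos_neq: "AE t in lborel. complex_of_real (cos (2 * pi * t)) \<noteq> s"
proof -
  have "countable {t. complex_of_real (cos (2 * pi * t)) = s}"
  proof (cases "\<exists>u. complex_of_real (cos (2 * pi * u)) = s")
    case True
    then obtain u where u: "complex_of_real (cos (2 * pi * u)) = s" by blast
    \<comment> \<open>A level set of the cosine is at most two translates of the integers, hence
      countable.\<close>
    have "t \<in> (\<lambda>n. u + n) ` \<int> \<union> (\<lambda>n. - u + n) ` \<int>" if "complex_of_real (cos (2 * pi * t)) = s" for t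
    proof -
      have "cos (2 * pi * t) = cos (2 * pi * u)" using that u by (metis of_real_eq_iff)
      then obtain n where n: "n \<in> \<int>"
          "2 * pi * t = 2 * pi * u + 2 * n * pi \<or> 2 * pi * t = - (2 * pi * u) + 2 * n * pi"
        unfolding cos_eq by blast
      then have "2 * pi * t = 2 * pi * (u + n) \<or> 2 * pi * t = 2 * pi * (- u + n)"
        by (simp add: algebra_simps)
      then have "t = u + n \<or> t = - u + n" by simp
      with n(1) show ?thesis by blast
    qed
    then have "{t. complex_of_real (cos (2 * pi * t)) = s} \<subseteq> (\<lambda>n. u + n) ` \<int> \<union> (\<lambda>n. - u + n) ` \<int>"
      by blast
    then show ?thesis
      by (rule countable_subset) (simp add: Ints_def)
  qed simp
  from AE_not_in[OF countable_imp_null_set_lborel[OF this]] show ?thesis by simp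
qed

text \<open>For nonzero \<open>B\<close> a zero determines the cosine, whose coefficient
  \<open>2 * B * z\<close> does not vanish; for \<open>B = 0\<close> the value is
  \<open>A\<close>.\<close>

lemma AE_affine_cos_neq:
  fixes A B z :: complex
  assumes "A \<noteq> 0" "z \<noteq> 0"
  shows "AE t in lborel. A + B * (1 + 2 * of_real (cos (2 * pi * t)) * z + z\<^sup>2) \<noteq> 0"
proof (cases "B = 0")
  case False
  have "complex_of_real (cos (2 * pi * t)) = (- A / B - 1 - z\<^sup>2) / (2 * z)"
    if "A + B * (1 + 2 * of_real (cos (2 * pi * t)) * z + z\<^sup>2) = 0" for t
    using that False assms(2) by (simp add: field_simps) algebra
  with AE_cos_neq[of "(- A / B - 1 - z\<^sup>2) / (2 * z)"] show ?thesis by (auto elim!: eventually_mono)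
qed (use assms in simp)

text \<open>A shift by \<alpha> multiplies the transform by the plane wave at -\<alpha>, whence the
  minus sign for the positive direction.\<close>

definition direction_phase :: "('d \<Rightarrow> real) \<Rightarrow> 'd \<times> bool \<Rightarrow> complex" where
  "direction_phase k c = cis (if snd c then - (2 * pi * k (fst c)) else 2 * pi * k (fst c))"

lemma norm_direction_phase [simp]: "norm (direction_phase k c) = 1"
  by (simp add: direction_phase_def)

lemma direction_phase_opposite: "direction_phase k (j, True) * direction_phase k (j, False) = 1"
  by (simp add: direction_phase_def cis_mult)

lemma measurable_direction_phase [measurable]: "(\<lambda>k. direction_phase k c) \<in> borel_measurable torus"
  unfolding direction_phase_def cis_conv_exp by measurable

lemma poly_pair_poly:
  "poly (pair_poly (direction_phase k) j) z = 1 + 2 * of_real (cos (2 * pi * k j)) * z + z\<^sup>2"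
proof -
  have "direction_phase k (j, True) + direction_phase k (j, False) = 2 * of_real (cos (2 * pi * k j))"
    by (simp add: direction_phase_def complex_eq_iff)
  then show ?thesis by (simp add: pair_poly_def power2_eq_square algebra_simps)
qed

lemma poly_walk_poly:
  "poly (walk_poly \<zeta>) z = (\<Sum>j\<in>UNIV. \<Prod>i\<in>UNIV - {j}. poly (pair_poly \<zeta> i) z)"
  by (simp add: walk_poly_def poly_sum poly_prod)

lemma measurable_poly_pair_poly [measurable]:
  "(\<lambda>k. poly (pair_poly (direction_phase k) j) z) \<in> borel_measurable torus"
  unfolding poly_pair_poly by measurable

lemma measurable_poly_walk_poly [measurable]:
  "(\<lambda>k. poly (walk_poly (direction_phase k)) z) \<in> borel_measurable torus"
  unfolding poly_walk_poly by measurable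

lemma AE_poly_pair_poly:
  assumes "z \<noteq> 0"
  shows "AE k in torus. poly (pair_poly (direction_phase k) j) z \<noteq> 0"
proof (rule AE_torus_slice)
  show "AE t in lborel. poly (pair_poly (direction_phase (k(j := t))) j) z \<noteq> 0" for k
  proof -
    have "AE t in lborel. complex_of_real (cos (2 * pi * t)) \<noteq> (- 1 - z\<^sup>2) / (2 * z)"
      by (rule AE_cos_neq)
    moreover have "complex_of_real (cos (2 * pi * t)) = (- 1 - z\<^sup>2) / (2 * z)"
      if "1 + 2 * complex_of_real (cos (2 * pi * t)) * z + z\<^sup>2 = 0" for t
      using that assms by (simp add: field_simps) algebra
    ultimately show ?thesis by (auto simp: poly_pair_poly elim!: AE_mp)
  qed
qed measurable

text \<open>Once no $M_i$ vanishes at \<open>z\<close>, the walk polynomial is a nonconstant affine function, or a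
  nonzero constant, of the cosine of a single momentum coordinate.\<close>

lemma AE_poly_walk_poly:
  assumes z: "z \<noteq> 0"
  shows "AE k in torus. poly (walk_poly (direction_phase (k :: 'd::finite \<Rightarrow> real))) z \<noteq> 0"
proof -
  fix j :: 'd
  define m where "m k i = poly (pair_poly (direction_phase k) i) z" for k and i :: 'd
  have m_upd: "m (k(j := t)) i = m k i" if "i \<noteq> j" for k t i
    using that by (simp add: m_def poly_pair_poly)
  have mj: "m (k(j := t)) j = 1 + 2 * of_real (cos (2 * pi * t)) * z + z\<^sup>2" for k t
    by (simp add: m_def poly_pair_poly)
  \<comment> \<open>\<open>A\<close> is the summand omitting the factor of \<open>j\<close>;
    \<open>B\<close> collects the others with that factor taken out. Neither involves
    \<open>k j\<close>.\<close>
  define A where "A k = (\<Prod>i\<in>UNIV - {j}. m k i)" for k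
  define B where "B k = (\<Sum>l\<in>UNIV - {j}. \<Prod>i\<in>UNIV - {l} - {j}. m k i)" for k
  have split: "poly (walk_poly (direction_phase k)) z = A k + B k * m k j" for k
  proof -
    have "(\<Prod>i\<in>UNIV - {l}. m k i) = (\<Prod>i\<in>UNIV - {l} - {j}. m k i) * m k j" if "l \<noteq> j" for l
      using that by (subst prod.remove[of _ j]) (auto simp: mult.commute)
    then have "(\<Sum>l\<in>UNIV - {j}. \<Prod>i\<in>UNIV - {l}. m k i) = B k * m k j"
      unfolding B_def sum_distrib_right by (intro sum.cong) auto
    moreover have "poly (walk_poly (direction_phase k)) z
       = (\<Prod>i\<in>UNIV - {j}. m k i) + (\<Sum>l\<in>UNIV - {j}. \<Prod>i\<in>UNIV - {l}. m k i)"
      unfolding poly_walk_poly m_def[symmetric] by (subst sum.remove[of _ j]) auto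
    ultimately show ?thesis by (simp add: A_def)
  qed
  have "AE k in torus. (\<forall>i\<in>UNIV. m k i \<noteq> 0)"
    unfolding m_def by (intro AE_finite_allI AE_poly_pair_poly z) simp
  moreover have "AE k in torus. (\<forall>i. m k i \<noteq> 0) \<longrightarrow> poly (walk_poly (direction_phase k)) z \<noteq> 0"
  proof (rule AE_torus_slice)
    show "Measurable.pred torus (\<lambda>k. (\<forall>i. m k i \<noteq> 0) \<longrightarrow> poly (walk_poly (direction_phase k)) z \<noteq> 0)"
      unfolding m_def by measurable
    \<comment> \<open>If \<open>A k\<close> vanishes, then so does a factor that is constant along
      the line, and the premise fails on the whole line. Otherwise the affine lemma applies.\<close>
    show "AE t in lborel. (\<forall>i. m (k(j := t)) i \<noteq> 0) \<longrightarrow> poly (walk_poly (direction_phase (k(j := t)))) z \<noteq> 0" for k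
    proof (cases "A k = 0")
      case True
      then obtain i where "i \<noteq> j" "m k i = 0" by (auto simp: A_def)
      then have "m (k(j := t)) i = 0" for t by (simp add: m_upd)
      then show ?thesis by (intro AE_I2) blast
    next
      case False
      have "A (k(j := t)) = A k" "B (k(j := t)) = B k" for t
        unfolding A_def B_def by (auto intro!: prod.cong sum.cong simp: m_upd)
      then have "poly (walk_poly (direction_phase (k(j := t)))) z
         = A k + B k * (1 + 2 * of_real (cos (2 * pi * t)) * z + z\<^sup>2)" for t
        by (simp add: split mj)
      with AE_affine_cos_neq[OF False z, of "B k"] show ?thesis by (auto elim!: eventually_mono)
    qed
  qed
  ultimately show ?thesis by eventually_elim auto
qed

section \<open>Plane waves and Fourier inversion for point masses\<close>

definition plane_wave :: "('d::finite \<Rightarrow> real) \<Rightarrow> ('d \<Rightarrow> int) \<Rightarrow> complex" where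
  "plane_wave k x = (\<Prod>i\<in>UNIV. cis (2 * pi * of_int (x i) * k i))"

lemma norm_plane_wave [simp]: "norm (plane_wave k x) = 1"
  by (simp add: plane_wave_def prod_norm[symmetric])

lemma measurable_plane_wave [measurable]: "(\<lambda>k. plane_wave k x) \<in> borel_measurable torus"
  unfolding plane_wave_def cis_conv_exp by measurable

lemma plane_wave_diff: "plane_wave k (\<lambda>i. x i - y i) = plane_wave k x * plane_wave k (\<lambda>i. - y i)"
  unfolding plane_wave_def prod.distrib[symmetric]
  by (intro prod.cong refl) (simp add: cis_mult algebra_simps)

lemma plane_wave_std_dir: "plane_wave k (\<lambda>i. - std_dir c i) = direction_phase k c"
proof -
  have "plane_wave k (\<lambda>i. - std_dir c i) = (\<Prod>i\<in>UNIV. if i = fst c then direction_phase k c else 1)"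
    unfolding plane_wave_def
    by (intro prod.cong refl) (auto simp: std_dir_def direction_phase_def)
  then show ?thesis by simp
qed

lemma measurable_character: "(\<lambda>t. cis (a * t)) \<in> borel_measurable borel"
  unfolding cis_conv_exp by (intro borel_measurable_continuous_onI continuous_intros)

lemma integral_circle_character:
  "(\<integral>t. cis (2 * pi * of_int m * t) \<partial>circle) = (if m = 0 then 1 else 0)"
proof -
  have meas: "(\<lambda>t. cis (2 * pi * of_int m * t)) \<in> borel_measurable lborel"
    using measurable_character by simp
  have eq: "(\<integral>t. cis (2 * pi * of_int m * t) \<partial>circle)
     = (\<integral>t. indicator {0..1} t *\<^sub>R cis (2 * pi * of_int m * t) \<partial>lborel)"
    unfolding circle_def ennreal_indicator[symmetric] by (rule integral_density[OF meas]) auto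
  show ?thesis
  proof (cases "m = 0")
    case True
    then show ?thesis unfolding eq by simp
  next
    case False
    define w where "w = 2 * pi * of_int m * \<i>"
    have w: "w \<noteq> 0" using False by (simp add: w_def)
    have cis: "cis (2 * pi * of_int m * t) = exp (w * of_real t)" for t
      by (simp add: cis_conv_exp w_def mult_ac)
    have "(\<integral>t. indicator {0..1} t *\<^sub>R cis (2 * pi * of_int m * t) \<partial>lborel)
      = exp (w * of_real 1) / w - exp (w * of_real 0) / w"
      unfolding cis
    proof (rule integral_FTC_Icc)
      show "((\<lambda>t. exp (w * of_real t) / w) has_vector_derivative exp (w * of_real t)) (at t within {0..1})" for t
      proof -
        have "((\<lambda>u. exp (w * u) / w) has_field_derivative exp (w * of_real t)) (at (of_real t))"
          using w by (auto intro!: derivative_eq_intros)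
        then show ?thesis
          using has_vector_derivative_real_field[of "\<lambda>u. exp (w * u) / w"] by (metis has_vector_derivative_at_within)
      qed
    qed (auto intro!: continuous_intros)
    also have "exp (w * of_real 1) = 1"
    proof -
      have "cis (2 * pi * of_int m * 1) = 1" using cis_multiple_2pi[of "of_int m"] by (simp add: mult_ac)
      then show ?thesis using cis[of 1] by simp
    qed
    finally show ?thesis unfolding eq using False by simp
  qed
qed

lemma integral_plane_wave:
  fixes x :: "'d::finite \<Rightarrow> int"
  shows "(\<integral>k. plane_wave k x \<partial>torus) = (if x = (\<lambda>i. 0) then 1 else 0)"
proof -
  interpret product_prob_space "\<lambda>_::'d. circle"
    by (intro product_prob_spaceI prob_space_circle)
  have int: "integrable circle (\<lambda>t. cis (2 * pi * of_int m * t))" for m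
    by (rule finite_measure.integrable_const_bound[OF prob_space.axioms(1)[OF prob_space_circle], of _ 1]) (auto simp: measurable_character cong: measurable_cong_sets)
  have "(\<integral>k. plane_wave k x \<partial>torus) = (\<Prod>i\<in>UNIV. \<integral>t. cis (2 * pi * of_int (x i) * t) \<partial>circle)"
    unfolding plane_wave_def torus_def by (rule product_integral_prod) (auto intro: int)
  also have "\<dots> = (if x = (\<lambda>i. 0) then 1 else 0)"
    by (auto simp: integral_circle_character fun_eq_iff)
  finally show ?thesis .
qed

definition fourier_step :: "('d::finite \<Rightarrow> real) \<Rightarrow> ('d \<times> bool \<Rightarrow> complex) \<Rightarrow> 'd \<times> bool \<Rightarrow> complex" where
  "fourier_step k v = (\<lambda>c. direction_phase k c * grover v c)"

text \<open>The starting vector is the Fourier transform of \<open>delta_at y \<phi>\<close> at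
  \<open>k\<close>. Translation invariance lets each momentum evolve on its own.\<close>

definition fourier_orbit ::
  "('d::finite \<Rightarrow> int) \<Rightarrow> ('d \<times> bool \<Rightarrow> complex) \<Rightarrow> ('d \<Rightarrow> real) \<Rightarrow> nat \<Rightarrow> 'd \<times> bool \<Rightarrow> complex" where
  "fourier_orbit y \<phi> k n = (fourier_step k ^^ n) (\<lambda>c. plane_wave k (\<lambda>i. - y i) * \<phi> c)"

lemma fourier_orbit_Suc:
  "fourier_orbit y \<phi> k (Suc n) c = direction_phase k c * grover (fourier_orbit y \<phi> k n) c"
  by (simp add: fourier_orbit_def fourier_step_def)

lemma vnorm2_fourier_orbit: "vnorm2 (fourier_orbit y \<phi> k n) = vnorm2 \<phi>"
proof (induction n)
  case 0
  then show ?case by (simp add: fourier_orbit_def vnorm2_scale)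
next
  case (Suc n)
  have "vnorm2 (fourier_orbit y \<phi> k (Suc n)) = vnorm2 (grover (fourier_orbit y \<phi> k n))"
    by (simp add: vnorm2_def fourier_orbit_Suc norm_mult)
  with Suc show ?case by (simp add: vnorm2_grover)
qed

lemma norm_fourier_orbit: "norm (fourier_orbit y \<phi> k n c) \<le> sqrt (vnorm2 \<phi>)"
  by (rule real_le_rsqrt) (metis component_le_vnorm2 vnorm2_fourier_orbit)

lemma measurable_fourier_orbit [measurable]: "(\<lambda>k. fourier_orbit y \<phi> k n c) \<in> borel_measurable torus"
proof (induction n arbitrary: c)
  case 0
  then show ?case by (simp add: fourier_orbit_def)
next
  case (Suc n)
  note [measurable] = Suc
  show ?case unfolding fourier_orbit_Suc grover_def by measurable
qed

lemma integrable_fourier_orbit: "integrable torus (\<lambda>k. plane_wave k x * fourier_orbit y \<phi> k n c)"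
proof -
  interpret prob_space "torus :: ('a \<Rightarrow> real) measure" by (rule prob_space_torus)
  show ?thesis
    by (rule integrable_const_bound[of _ "sqrt (vnorm2 \<phi>)"]) (auto simp: norm_mult norm_fourier_orbit)
qed

text \<open>Induction on time: orthogonality of characters gives time 0, and both sides then obey
  the same linear recursion. No Fourier transform of a general state is involved.\<close>

lemma walk_fourier:
  "(U_std ^^ n) (delta_at y \<phi>) x c = (\<integral>k. plane_wave k x * fourier_orbit y \<phi> k n c \<partial>torus)"
proof (induction n arbitrary: x c)
  case 0
  have "plane_wave k x * (plane_wave k (\<lambda>i. - y i) * \<phi> c) = plane_wave k (\<lambda>i. x i - y i) * \<phi> c" for k
    by (simp add: plane_wave_diff)
  then have "(\<integral>k. plane_wave k x * fourier_orbit y \<phi> k 0 c \<partial>torus) = (\<integral>k. plane_wave k (\<lambda>i. x i - y i) \<partial>torus) * \<phi> c"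
    unfolding fourier_orbit_def funpow_0 by (simp only: integral_mult_left_zero)
  then show ?case by (auto simp: integral_plane_wave delta_at_def fun_eq_iff)
next
  case (Suc n)
  \<comment> \<open>The phase of direction \<open>c\<close> is absorbed into the plane wave by
    moving the evaluation point one step back.\<close>
  define x' where "x' = (\<lambda>i. x i - std_dir c i)"
  have wave: "plane_wave k x * direction_phase k c = plane_wave k x'" for k
    by (simp add: x'_def plane_wave_diff plane_wave_std_dir)
  have step: "plane_wave k x * fourier_orbit y \<phi> k (Suc n) c
     = (2 / of_nat CARD('a \<times> bool)) * (\<Sum>b\<in>UNIV. plane_wave k x' * fourier_orbit y \<phi> k n b) - plane_wave k x' * fourier_orbit y \<phi> k n c" for k
  proof -
    have "plane_wave k x * fourier_orbit y \<phi> k (Suc n) c = plane_wave k x' * grover (fourier_orbit y \<phi> k n) c"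
      by (simp only: fourier_orbit_Suc wave mult.assoc[symmetric])
    then show ?thesis by (simp only: grover_def right_diff_distrib sum_distrib_left mult.left_commute)
  qed
  have "(\<integral>k. plane_wave k x * fourier_orbit y \<phi> k (Suc n) c \<partial>torus)
    = (2 / of_nat CARD('a \<times> bool)) * (\<Sum>b\<in>UNIV. \<integral>k. plane_wave k x' * fourier_orbit y \<phi> k n b \<partial>torus)
      - (\<integral>k. plane_wave k x' * fourier_orbit y \<phi> k n c \<partial>torus)"
    unfolding step
    by (subst Bochner_Integration.integral_diff)
       (auto intro!: integrable_mult_right Bochner_Integration.integrable_sum integrable_fourier_orbit
         simp: Bochner_Integration.integral_sum integrable_fourier_orbit)
  also have "\<dots> = (U_std ^^ Suc n) (delta_at y \<phi>) x c"
    unfolding Suc[symmetric] x'_def funpow.simps comp_apply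
    by (subst U_std_def) (simp only: grover_def)
  finally show ?case by simp
qed

section \<open>Time means of momentum integrals\<close>

lemma mean_integral_tendsto_0:
  fixes b :: "'k \<Rightarrow> nat \<Rightarrow> complex" and d :: "nat \<Rightarrow> complex" and e :: "'k \<Rightarrow> complex"
  assumes P: "prob_space P"
    and b[measurable]: "\<And>n. (\<lambda>k. b k n) \<in> borel_measurable P" and bb: "\<And>k n. norm (b k n) \<le> C"
    and e[measurable]: "e \<in> borel_measurable P" and eb: "\<And>k. norm (e k) \<le> 1"
    and db: "\<And>n. norm (d n) \<le> D"
    and lim: "AE k in P. (\<lambda>N. (1 / of_nat N) * (\<Sum>n=1..N. b k n * d n)) \<longlonglongrightarrow> 0"
  shows "(\<lambda>N. (1 / of_nat N) * (\<Sum>n=1..N. (\<integral>k. e k * b k n \<partial>P) * d n)) \<longlonglongrightarrow> 0"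
proof -
  interpret prob_space P by (rule P)
  have "norm (e k * b k n) \<le> C" for k n
    using mult_mono[OF eb[of k] bb[of k n]] by (simp add: norm_mult)
  then have int: "integrable P (\<lambda>k. e k * b k n)" for n
    by (intro integrable_const_bound[of _ C]) auto
  define s where "s N k = e k * ((1 / of_nat N) * (\<Sum>n=1..N. b k n * d n))" for N k
  have "s N k = (1 / of_nat N) * (\<Sum>n=1..N. (e k * b k n) * d n)" for N k
    by (simp add: s_def sum_distrib_left mult_ac)
  then have eq: "(\<integral>k. s N k \<partial>P) = (1 / of_nat N) * (\<Sum>n=1..N. (\<integral>k. e k * b k n \<partial>P) * d n)" for N
    using int by (simp add: Bochner_Integration.integral_sum del: One_nat_def)
  have C: "0 \<le> C" and D: "0 \<le> D" using bb db norm_ge_zero order.trans by blast+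
  \<comment> \<open>Since \<open>d\<close> does not depend on \<open>k\<close>, the time mean can be
    taken inside the integral; means of terms bounded by \<open>C * D\<close> keep this bound, so
    dominated convergence applies.\<close>
  have "(\<lambda>N. \<integral>k. s N k \<partial>P) \<longlonglongrightarrow> (\<integral>k. 0 \<partial>P)"
  proof (rule integral_dominated_convergence[where w = "\<lambda>_. C * D"])
    show "s N \<in> borel_measurable P" for N unfolding s_def by measurable
    show "AE k in P. (\<lambda>N. s N k) \<longlonglongrightarrow> 0"
      using lim by eventually_elim (use tendsto_mult_left[of _ 0] in \<open>force simp: s_def\<close>)
    show "AE k in P. norm (s N k) \<le> C * D" for N
    proof (rule AE_I2)
      fix k
      have "norm (\<Sum>n=1..N. b k n * d n) \<le> real (card {1..N}) * (C * D)"
        by (rule sum_norm_bound) (auto simp: norm_mult intro!: mult_mono bb db C)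
      then have "norm ((1 / of_nat N) * (\<Sum>n=1..N. b k n * d n)) \<le> C * D"
        using C D by (cases "N = 0") (auto simp: norm_mult norm_divide divide_le_eq mult.commute simp del: One_nat_def)
      then have "norm (e k) * norm ((1 / of_nat N) * (\<Sum>n=1..N. b k n * d n)) \<le> 1 * (C * D)"
        by (intro mult_mono eb) auto
      then show "norm (s N k) \<le> C * D" by (simp only: s_def norm_mult mult_1)
    qed
  qed auto
  then show ?thesis by (simp add: eq)
qed

text \<open>Fubini: the square of the integral is an integral over pairs \<open>(k, k')\<close>, for which the
  time averages vanish separately.\<close>

lemma null_mean_square_integral:
  fixes a :: "'k \<Rightarrow> nat \<Rightarrow> complex" and e :: "'k \<Rightarrow> complex"
  assumes P: "prob_space P"
    and a[measurable]: "\<And>n. (\<lambda>k. a k n) \<in> borel_measurable P" and ab: "\<And>k n. norm (a k n) \<le> C"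
    and e[measurable]: "e \<in> borel_measurable P" and eb: "\<And>k. norm (e k) \<le> 1"
    and lim: "\<And>k'. AE k in P. (\<lambda>N. (1 / of_nat N) * (\<Sum>n=1..N. a k n * cnj (a k' n))) \<longlonglongrightarrow> 0"
  shows "null_mean_square (\<lambda>n. \<integral>k. e k * a k n \<partial>P)"
proof -
  interpret prob_space P by (rule P)
  define A where "A n = (\<integral>k. e k * a k n \<partial>P)" for n
  have C: "0 \<le> C" using ab norm_ge_zero order.trans by blast
  have Ab: "norm (A n) \<le> C" for n
  proof -
    have eab: "norm (e k * a k n) \<le> C" for k
      using mult_mono[OF eb[of k] ab[of k n]] by (simp add: norm_mult)
    then have int: "integrable P (\<lambda>k. e k * a k n)"
      by (intro integrable_const_bound[of _ C]) auto
    have "norm (A n) \<le> (\<integral>k. norm (e k * a k n) \<partial>P)" unfolding A_def by (rule integral_norm_bound)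
    also have "\<dots> \<le> C"
      by (rule integral_le_const[OF integrable_norm[OF int]]) (use eab in simp)
    finally show ?thesis .
  qed
  \<comment> \<open>First integration, over \<open>k\<close> with \<open>k'\<close> frozen.\<close>
  have 1: "(\<lambda>N. (1 / of_nat N) * (\<Sum>n=1..N. A n * cnj (a k' n))) \<longlonglongrightarrow> 0" for k'
    unfolding A_def by (rule mean_integral_tendsto_0[OF P a ab e eb _ lim, where D = C]) (simp add: ab)
  have cnj: "cnj \<in> borel_measurable borel"
    by (intro borel_measurable_continuous_onI continuous_intros)
  \<comment> \<open>Second integration, over \<open>k'\<close>, with the bounded sequence
    \<open>A\<close> in the role of \<open>d\<close>; the pointwise limits are those of
    \<open>1\<close>.\<close>
  have "(\<lambda>N. (1 / of_nat N) * (\<Sum>n=1..N. (\<integral>k'. cnj (e k') * cnj (a k' n) \<partial>P) * A n)) \<longlonglongrightarrow> 0"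
    by (rule mean_integral_tendsto_0[OF P, where C = C and D = C])
       (use 1 in \<open>auto simp: ab eb Ab mult.commute intro: measurable_compose[OF a cnj] measurable_compose[OF e cnj]\<close>)
  moreover have "(\<integral>k'. cnj (e k') * cnj (a k' n) \<partial>P) * A n = of_real ((norm (A n))\<^sup>2)" for n
  proof -
    have "(\<integral>k'. cnj (e k') * cnj (a k' n) \<partial>P) = cnj (A n)"
      unfolding A_def by (simp only: complex_cnj_mult[symmetric] Bochner_Integration.integral_cnj)
    then show ?thesis by (simp only: complex_norm_square) (simp only: mult.commute)
  qed
  ultimately have "(\<lambda>N. complex_of_real ((1 / real N) * (\<Sum>n=1..N. (norm (A n))\<^sup>2))) \<longlonglongrightarrow> of_real 0"
    by simp
  then show ?thesis unfolding null_mean_square_def A_def tendsto_of_real_iff .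
qed

lemma walk_null_mean_square:
  fixes \<phi> :: "'d::finite \<times> bool \<Rightarrow> complex"
  shows "null_mean_square (\<lambda>n. (U_std ^^ (n + 2)) (delta_at y \<phi>) x c - (U_std ^^ n) (delta_at y \<phi>) x c)"
proof -
  define v where "v = fourier_orbit y \<phi>"
  define a where "a k n = v k (Suc (Suc n)) c - v k n c" for k n
  define p where "p k = pair_poly (direction_phase k) (fst c) * walk_poly (direction_phase k)" for k :: "'d \<Rightarrow> real"
  have rec: "shift_poly (p k) (a k) n = 0" for k n
    unfolding p_def a_def
    by (rule walk_recurrence) (simp_all add: v_def fourier_orbit_Suc grover_eq direction_phase_opposite)
  \<comment> \<open>Conjugation swaps the phases of opposite directions and so leaves
    \<open>pair_poly\<close> and \<open>walk_poly\<close> unchanged.\<close>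
  have rec': "shift_poly (p k) (\<lambda>n. cnj (a k n)) n = 0" for k n
  proof -
    have pp: "pair_poly (\<lambda>c. cnj (direction_phase k c)) = pair_poly (direction_phase k)"
      by (rule ext) (simp add: pair_poly_def direction_phase_def cis_cnj add.commute)
    then have "walk_poly (\<lambda>c. cnj (direction_phase k c)) = walk_poly (direction_phase k)"
      by (simp add: walk_poly_def)
    moreover have "shift_poly (pair_poly (\<lambda>c. cnj (direction_phase k c)) (fst c) * walk_poly (\<lambda>c. cnj (direction_phase k c)))
        (\<lambda>n. cnj (v k (Suc (Suc n)) c) - cnj (v k n c)) n = 0"
    proof (rule walk_recurrence[where v = "\<lambda>n c. cnj (v k n c)"])
      show "cnj (direction_phase k (j, True)) * cnj (direction_phase k (j, False)) = 1" for j
        by (metis complex_cnj_mult complex_cnj_one direction_phase_opposite)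
    qed (simp add: v_def fourier_orbit_Suc grover_eq)
    ultimately show ?thesis by (simp add: pp p_def a_def)
  qed
  \<comment> \<open>Every \<open>pair_poly\<close> has constant term 1, so at 0 the walk polynomial
    counts its d summands.\<close>
  have pnz: "p k \<noteq> 0" for k
  proof -
    have "poly (p k) 0 = of_nat CARD('d)"
      by (simp add: p_def poly_walk_poly pair_poly_def)
    then show ?thesis by auto
  qed
  have ab: "norm (a k n) \<le> 2 * sqrt (vnorm2 \<phi>)" for k n
    using norm_triangle_ineq4[of "v k (Suc (Suc n)) c" "v k n c"]
      norm_fourier_orbit[of y \<phi> k "Suc (Suc n)" c] norm_fourier_orbit[of y \<phi> k n c]
    unfolding a_def v_def by linarith
  have "null_mean_square (\<lambda>n. \<integral>k. plane_wave k x * a k n \<partial>torus)"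
  proof (rule null_mean_square_integral[OF prob_space_torus _ ab])
    show "(\<lambda>k. a k n) \<in> borel_measurable torus" for n unfolding a_def v_def by measurable
    fix k'
    \<comment> \<open>With \<open>k'\<close> fixed there are finitely many \<open>w\<close> to
      avoid, so the null sets of momenta for the individual roots can be united.\<close>
    have "AE k in torus. \<forall>w\<in>{w. poly (p k') w = 0} - {0}. poly (p k) (1 / w) \<noteq> 0"
    proof (rule AE_finite_allI)
      show "finite ({w. poly (p k') w = 0} - {0})" using poly_roots_finite[OF pnz[of k']] by simp
      show "AE k in torus. poly (p k) (1 / w) \<noteq> 0" if "w \<in> {w. poly (p k') w = 0} - {0}" for w
        using AE_poly_pair_poly[of "1 / w" "fst c"] AE_poly_walk_poly[of "1 / w"] that
        by (auto simp: p_def elim: AE_mp)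
    qed
    then show "AE k in torus. (\<lambda>N. (1 / of_nat N) * (\<Sum>n=1..N. a k n * cnj (a k' n))) \<longlonglongrightarrow> 0"
    proof eventually_elim
      case (elim k)
      show ?case
      proof (rule coprime_recurrences_mean[OF pnz[of k] rec[of k] rec'[of k'] ab])
        show "norm (cnj (a k' n)) \<le> 2 * sqrt (vnorm2 \<phi>)" for n using ab by simp
        show "poly (p k') (1 / z) \<noteq> 0" if "poly (p k) z = 0" "z \<noteq> 0" for z
        proof
          assume "poly (p k') (1 / z) = 0"
          then have "poly (p k) (1 / (1 / z)) \<noteq> 0" using elim that(2) by (auto simp del: divide_divide_eq_right)
          with that(1) show False by simp
        qed
      qed
    qed
  qed auto
  moreover have "(\<integral>k. plane_wave k x * a k n \<partial>torus)
     = (U_std ^^ (n + 2)) (delta_at y \<phi>) x c - (U_std ^^ n) (delta_at y \<phi>) x c" for n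
    unfolding walk_fourier a_def v_def right_diff_distrib
    by (subst Bochner_Integration.integral_diff) (auto intro: integrable_fourier_orbit)
  ultimately show ?thesis by simp
qed

section \<open>Point spectrum and time averages\<close>

lemma funpow_square: "(f ^^ n) (f (f x)) = (f ^^ (n + 2)) x"
  by (simp add: funpow_add numeral_2_eq_2 funpow_swap1)

lemma linear_walk_op_funpow: "linear (walk_op ^^ n)"
  by (rule linear_funpow[OF linear_walk_op])

lemma walk_decomposition:
  fixes f :: "'d::finite walk_state"
  obtains g h w where "f = g + h + w" "walk_op g = g" "walk_op h = - h"
    "\<And>e. null_mean_square (\<lambda>n. inner e ((walk_op ^^ n) w))"
proof -
  define b where "b y c k = state (delta_at y (\<lambda>d. if d = c then k else 0))" for y :: "'d \<Rightarrow> int" and c k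
  define B where "B = {b y c k | y c k. True}"
  have inner_b: "inner (b y c k) r = Re (cnj k * amp r y c)" for y c k and r :: "'d walk_state"
    unfolding b_def by (rule inner_delta)
  have tot: "r = 0" if r: "\<And>b. b \<in> B \<Longrightarrow> inner b r = 0" for r
  proof (rule walk_state_eqI)
    fix x c
    have "b x c k \<in> B" for k unfolding B_def by blast
    then have "inner (b x c 1) r = 0" "inner (b x c \<i>) r = 0" by (simp_all add: r)
    then show "amp r x c = amp 0 x c" unfolding inner_b by (simp add: complex_eq_iff)
  qed
  have mix: "null_mean_square (\<lambda>n. inner u ((walk_op ^^ n) (walk_op (walk_op v) - v)))"
    if uB: "u \<in> B" and vB: "v \<in> B" for u v
  proof -
    obtain y c k where u: "u = b y c k" using uB unfolding B_def by blast
    obtain y' \<phi> where v: "v = state (delta_at y' \<phi>)" using vB unfolding B_def b_def by blast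
    show ?thesis
    proof (rule null_mean_square_le[OF walk_null_mean_square])
      fix n
      have "amp ((walk_op ^^ n) (walk_op (walk_op v) - v)) y c
        = (U_std ^^ (n + 2)) (delta_at y' \<phi>) y c - (U_std ^^ n) (delta_at y' \<phi>) y c"
        unfolding linear_diff[OF linear_walk_op_funpow] funpow_square
        by (simp only: amp_diff amp_walk_op_funpow v amp_state in_ell2_delta)
      then show "norm (inner u ((walk_op ^^ n) (walk_op (walk_op v) - v)))
        \<le> norm k * norm ((U_std ^^ (n + 2)) (delta_at y' \<phi>) y c - (U_std ^^ n) (delta_at y' \<phi>) y c)"
        unfolding u inner_b
        by (metis abs_Re_le_cmod complex_mod_cnj norm_mult real_norm_def)
    qed
  qed
  show thesis
    by (rule isometry_decomposition[where B = B and f = f, OF linear_walk_op norm_walk_op surj_walk_op])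
       (use tot mix that in blast)+
qed

lemma null_mean_square_amp:
  assumes "\<And>e. null_mean_square (\<lambda>n. inner e ((walk_op ^^ n) w))"
  shows "null_mean_square (\<lambda>n. amp ((walk_op ^^ n) w) x c)"
proof -
  let ?z = "\<lambda>n. amp ((walk_op ^^ n) w) x c"
  have "null_mean_square (\<lambda>n. complex_of_real (Re (?z n)))"
    by (rule null_mean_square_le[where C = 1, OF assms[of "state (delta_at x (\<lambda>b. if b = c then 1 else 0))"]])
       (simp add: inner_delta)
  moreover have "null_mean_square (\<lambda>n. \<i> * complex_of_real (Im (?z n)))"
    by (rule null_mean_square_le[where C = 1, OF assms[of "state (delta_at x (\<lambda>b. if b = c then \<i> else 0))"]])
       (simp add: inner_delta norm_mult)
  ultimately have "null_mean_square (\<lambda>n. complex_of_real (Re (?z n)) + \<i> * complex_of_real (Im (?z n)))"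
    by (rule null_mean_square_add)
  then show ?thesis by (simp only: complex_eq[symmetric])
qed

section \<open>Eigenspaces and their orthogonal projections\<close>

lemma U_std_scale: "U_std (\<lambda>x c. k * f x c) = (\<lambda>x c. k * U_std f x c)"
  by (intro ext) (simp add: U_std_def grover_linear)

lemma U_std_funpow_eigenfunction:
  assumes "f \<in> eigenspace_U \<mu>"
  shows "(U_std ^^ n) f = (\<lambda>x c. \<mu> ^ n * f x c)"
proof (induction n)
  case (Suc n)
  then show ?case using assms by (simp add: U_std_scale eigenspace_U_def mult_ac)
qed simp

lemma eigenspace_scale: "f \<in> eigenspace_U \<mu> \<Longrightarrow> (\<lambda>x c. k * f x c) \<in> eigenspace_U \<mu>"
  by (simp add: eigenspace_U_def in_ell2_scale U_std_scale mult_ac)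

lemma eigenspace_diff:
  assumes "f \<in> eigenspace_U \<mu>" "g \<in> eigenspace_U \<mu>"
  shows "(\<lambda>x c. f x c - g x c) \<in> eigenspace_U \<mu>"
proof -
  have "U_std (\<lambda>x c. f x c - g x c) = (\<lambda>x c. U_std f x c - U_std g x c)"
    by (intro ext) (simp add: U_std_def grover_eq sum_subtractf diff_divide_distrib algebra_simps)
  then show ?thesis using assms by (simp add: eigenspace_U_def in_ell2_diff algebra_simps)
qed

text \<open>Eigenspaces are closed under multiplication by \<i>, which turns the imaginary part of
  the inner product into a real part.\<close>

lemma eigenspace_orthogonal:
  assumes "\<And>e. e \<in> eigenspace_U \<mu> \<Longrightarrow> Re (ell2_inner e f) = 0" and e: "e \<in> eigenspace_U \<mu>"
  shows "ell2_inner e f = 0"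
proof -
  have "Re (ell2_inner (\<lambda>x c. \<i> * e x c) f) = 0" by (intro assms(1) eigenspace_scale e)
  then have "Im (ell2_inner e f) = 0" by (simp add: ell2_inner_scale_left)
  with assms(1)[OF e] show ?thesis by (simp add: complex_eq_iff)
qed

text \<open>The definite description needs uniqueness: the difference of two candidates lies in the
  eigenspace and is orthogonal to it, hence to itself.\<close>

lemma orth_proj_eigenspace_eqI:
  assumes f: "in_ell2 f" and g: "g \<in> eigenspace_U \<mu>"
    and orth: "\<And>e. e \<in> eigenspace_U \<mu> \<Longrightarrow> ell2_inner e (\<lambda>x c. f x c - g x c) = 0"
  shows "orth_proj (eigenspace_U \<mu>) f = g"
  unfolding orth_proj_def
proof (rule the_equality)
  show "g \<in> eigenspace_U \<mu> \<and> (\<forall>h\<in>eigenspace_U \<mu>. ell2_inner h (\<lambda>x c. f x c - g x c) = 0)"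
    using g orth by blast
  fix g' assume g': "g' \<in> eigenspace_U \<mu> \<and> (\<forall>h\<in>eigenspace_U \<mu>. ell2_inner h (\<lambda>x c. f x c - g' x c) = 0)"
  define d where "d = (\<lambda>x c. g' x c - g x c)"
  have d: "d \<in> eigenspace_U \<mu>" unfolding d_def using g' g by (intro eigenspace_diff) auto
  have l2: "in_ell2 d" "in_ell2 g" "in_ell2 g'" using d g g' by (auto simp: eigenspace_U_def)
  have "ell2_inner d (\<lambda>x c. (f x c - g' x c) + d x c)
      = ell2_inner d (\<lambda>x c. f x c - g' x c) + ell2_inner d d"
    by (intro ell2_inner_add_right in_ell2_diff l2 f)
  then have "ell2_inner d d = 0"
    using g' d orth[OF d] by (simp add: d_def)
  then have "(\<Sum>\<^sub>\<infinity>x. vnorm2 (d x)) = 0" using ell2_inner_self[OF l2(1)] by simp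
  then have "d x = (\<lambda>c. 0)" for x
    using vnorm2_le_infsum[OF l2(1), of x] vnorm2_nonneg[of "d x"] vnorm2_eq_0_iff[of "d x"] by linarith
  then show "g' = g" by (simp add: d_def fun_eq_iff)
qed

text \<open>The summands of \<open>walk_decomposition\<close> are mutually orthogonal in the sense
  needed to recognise the first two as projections. The clause on inner products later certifies
  that a projection is nonzero.\<close>

lemma walk_spectral_decomposition:
  fixes f :: "('d::finite \<Rightarrow> int) \<Rightarrow> 'd \<times> bool \<Rightarrow> complex"
  assumes f: "in_ell2 f"
  obtains w where
    "orth_proj (eigenspace_U 1) f \<in> eigenspace_U 1"
    "orth_proj (eigenspace_U (-1)) f \<in> eigenspace_U (-1)"
    "\<And>e \<mu>. \<mu> = 1 \<or> \<mu> = -1 \<Longrightarrow> e \<in> eigenspace_U \<mu> \<Longrightarrow> ell2_inner e f = ell2_inner e (orth_proj (eigenspace_U \<mu>) f)"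
    "\<And>n x c. (U_std ^^ n) f x c = orth_proj (eigenspace_U 1) f x c
       + (-1) ^ n * orth_proj (eigenspace_U (-1)) f x c + w n x c"
    "\<And>x c. null_mean_square (\<lambda>n. w n x c)"
proof -
  obtain g h w where dec: "state f = g + h + w" and g: "walk_op g = g" and h: "walk_op h = - h"
    and w: "\<And>e. null_mean_square (\<lambda>n. inner e ((walk_op ^^ n) w))"
    by (rule walk_decomposition[of "state f"]) blast
  have f_eq: "f = (\<lambda>x c. amp g x c + amp h x c + amp w x c)"
    using arg_cong[OF dec, of amp] f by simp
  have g1: "amp g \<in> eigenspace_U 1" and h1: "amp h \<in> eigenspace_U (-1)"
    using arg_cong[OF g, of amp] arg_cong[OF h, of amp] by (auto simp: eigenspace_U_def)
  have iso: "inner (walk_op u) (walk_op v) = inner u v" for u v :: "'d walk_state"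
    by (rule isometry_inner[OF linear_walk_op norm_walk_op])
  have ison: "inner ((walk_op ^^ n) u) ((walk_op ^^ n) v) = inner u v" for n and u v :: "'d walk_state"
    by (induction n) (simp_all add: iso)
  \<comment> \<open>Moving both vectors along the walk changes the inner product only by a sign on
    the eigenvector side, so its modulus is constant in time; as a sequence null in mean square it
    must be 0.\<close>
  have ew: "ell2_inner e (amp w) = 0" if e: "e \<in> eigenspace_U \<mu>" and \<mu>: "\<mu> = 1 \<or> \<mu> = -1"
    for e :: "('d \<Rightarrow> int) \<Rightarrow> 'd \<times> bool \<Rightarrow> complex" and \<mu>
  proof (rule eigenspace_orthogonal[OF _ e])
    fix e :: "('d \<Rightarrow> int) \<Rightarrow> 'd \<times> bool \<Rightarrow> complex" assume e: "e \<in> eigenspace_U \<mu>"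
    define s where "s = state e"
    have l2: "in_ell2 e" using e by (simp add: eigenspace_U_def)
    obtain r :: real where r: "\<bar>r\<bar> = 1" "\<mu> = of_real r"
      using \<mu> by (metis abs_1 abs_minus_cancel of_real_1 of_real_minus)
    have "(walk_op ^^ n) s = (r ^ n) *\<^sub>R s" for n
      by (rule walk_state_eqI)
         (simp add: amp_walk_op_funpow s_def l2 U_std_funpow_eigenfunction[OF e] r(2))
    then have eq: "inner s w = r ^ n * inner s ((walk_op ^^ n) w)" for n
      by (metis ison inner_scaleR_left)
    have "norm (inner s w) \<le> 1 * norm (inner s ((walk_op ^^ n) w))" for n
      using arg_cong[OF eq[of n], of abs] r(1) by (simp add: abs_mult power_abs)
    then have "null_mean_square (\<lambda>n. inner s w)" by (rule null_mean_square_le[OF w])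
    then have "inner s w = 0" by (rule null_mean_square_const)
    then show "Re (ell2_inner e (amp w)) = 0" by (simp add: inner_walk_state_def s_def l2)
  qed
  have orth: "Re (ell2_inner e e') = 0" if e: "e \<in> eigenspace_U 1" and e': "e' \<in> eigenspace_U (-1)" for e e' :: "('d \<Rightarrow> int) \<Rightarrow> 'd \<times> bool \<Rightarrow> complex"
  proof -
    have l2: "in_ell2 e" "in_ell2 e'" using e e' by (auto simp: eigenspace_U_def)
    have "walk_op (state e) = state e" "walk_op (state e') = - state e'"
      using e e' by (auto intro!: walk_state_eqI simp: l2 eigenspace_U_def)
    then have "inner (state e) (state e') = 0" using iso[of "state e" "state e'"] by simp
    then show ?thesis by (simp add: inner_walk_state_def l2)
  qed
  have eh: "ell2_inner e (amp h) = 0" if "e \<in> eigenspace_U 1" for e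
    by (rule eigenspace_orthogonal[OF _ that]) (rule orth[OF _ h1])
  have eg: "ell2_inner e (amp g) = 0" if "e \<in> eigenspace_U (-1)" for e
    by (rule eigenspace_orthogonal[OF _ that]) (subst ell2_inner_cnj, simp add: orth[OF g1])
  have P1: "orth_proj (eigenspace_U 1) f = amp g"
  proof (rule orth_proj_eigenspace_eqI[OF f g1])
    fix e :: "('d \<Rightarrow> int) \<Rightarrow> 'd \<times> bool \<Rightarrow> complex" assume e: "e \<in> eigenspace_U 1"
    have "ell2_inner e (\<lambda>x c. amp h x c + amp w x c) = ell2_inner e (amp h) + ell2_inner e (amp w)"
      using e by (intro ell2_inner_add_right) (auto simp: eigenspace_U_def)
    then show "ell2_inner e (\<lambda>x c. f x c - amp g x c) = 0"
      using ew[OF e] eh[OF e] by (simp add: f_eq algebra_simps)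
  qed
  have P2: "orth_proj (eigenspace_U (-1)) f = amp h"
  proof (rule orth_proj_eigenspace_eqI[OF f h1])
    fix e :: "('d \<Rightarrow> int) \<Rightarrow> 'd \<times> bool \<Rightarrow> complex" assume e: "e \<in> eigenspace_U (-1)"
    have "ell2_inner e (\<lambda>x c. amp g x c + amp w x c) = ell2_inner e (amp g) + ell2_inner e (amp w)"
      using e by (intro ell2_inner_add_right) (auto simp: eigenspace_U_def)
    then show "ell2_inner e (\<lambda>x c. f x c - amp h x c) = 0"
      using ew[OF e] eg[OF e] by (simp add: f_eq algebra_simps)
  qed
  have inner_f: "ell2_inner e f = ell2_inner e (amp g) + ell2_inner e (amp h) + ell2_inner e (amp w)"
    if "in_ell2 e" for e
    unfolding f_eq using that by (simp add: ell2_inner_add_right in_ell2_add)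
  show thesis
  proof (rule that[of "\<lambda>n. amp ((walk_op ^^ n) w)"])
    show "orth_proj (eigenspace_U 1) f \<in> eigenspace_U 1" "orth_proj (eigenspace_U (-1)) f \<in> eigenspace_U (-1)"
      unfolding P1 P2 by (fact g1 h1)+
    show "ell2_inner e f = ell2_inner e (orth_proj (eigenspace_U \<mu>) f)"
      if \<mu>: "\<mu> = 1 \<or> \<mu> = -1" and e: "e \<in> eigenspace_U \<mu>" for e \<mu>
    proof -
      have "in_ell2 e" using e by (simp add: eigenspace_U_def)
      from inner_f[OF this] show ?thesis using \<mu> e eh[of e] eg[of e] ew[OF e \<mu>] P1 P2 by auto
    qed
    fix x c
    show "null_mean_square (\<lambda>n. amp ((walk_op ^^ n) w) x c)" by (rule null_mean_square_amp[OF w])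
    fix n
    have "amp ((walk_op ^^ n) (g + h + w)) x c
      = amp ((walk_op ^^ n) g) x c + amp ((walk_op ^^ n) h) x c + amp ((walk_op ^^ n) w) x c"
      by (simp only: linear_add[OF linear_walk_op_funpow] amp_add)
    then show "(U_std ^^ n) f x c = orth_proj (eigenspace_U 1) f x c
       + (-1) ^ n * orth_proj (eigenspace_U (-1)) f x c + amp ((walk_op ^^ n) w) x c"
      unfolding dec[symmetric] P1 P2
      using U_std_funpow_eigenfunction[OF g1, of n] U_std_funpow_eigenfunction[OF h1, of n]
      by (simp add: amp_walk_op_funpow[of n "state f"] amp_walk_op_funpow[of n g] amp_walk_op_funpow[of n h] f)
  qed
qed

section \<open>Time averages and exclusion of other eigenvalues\<close>

lemma mean_power_tendsto_0:
  fixes \<omega> :: complex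
  assumes "norm \<omega> = 1" "\<omega> \<noteq> 1"
  shows "(\<lambda>N. (1 / of_nat N) * (\<Sum>n=1..N. \<omega> ^ n)) \<longlonglongrightarrow> 0"
proof -
  have "(\<lambda>N. (1 / of_nat N) * (\<Sum>n=1..N. \<omega> ^ n - \<omega> ^ Suc n)) \<longlonglongrightarrow> 0"
    by (rule mean_telescope[of _ 1]) (simp add: norm_power assms(1))
  from tendsto_mult_left[OF this, of "1 / (1 - \<omega>)"]
  have lim: "(\<lambda>N. 1 / (1 - \<omega>) * ((1 / of_nat N) * (\<Sum>n=1..N. \<omega> ^ n - \<omega> ^ Suc n))) \<longlonglongrightarrow> 0" by simp
  have "(\<Sum>n=1..N. \<omega> ^ n - \<omega> ^ Suc n) = (1 - \<omega>) * (\<Sum>n=1..N. \<omega> ^ n)" for N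
    by (simp add: sum_distrib_left algebra_simps)
  then have "1 / (1 - \<omega>) * ((1 / of_nat N) * (\<Sum>n=1..N. \<omega> ^ n - \<omega> ^ Suc n)) = (1 / of_nat N) * (\<Sum>n=1..N. \<omega> ^ n)" for N
    using assms(2) by simp
  with lim show ?thesis by simp
qed

text \<open>In the expanded square the cross term of \<open>a\<close> and \<open>b\<close> carries
  \<open>(-1)^n\<close> and averages to 0; the cross terms with \<open>w\<close> vanish in the mean
  because the other factor is bounded.\<close>

lemma mean_square_two_phases:
  fixes a b :: complex
  assumes w: "null_mean_square w"
  shows "(\<lambda>N. (1 / real N) * (\<Sum>n=1..N. (cmod (a + (-1) ^ n * b + w n))\<^sup>2)) \<longlonglongrightarrow> (cmod a)\<^sup>2 + (cmod b)\<^sup>2"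
proof -
  define u where "u n = a + (-1) ^ n * b" for n :: nat
  have ub: "norm (cnj (u n)) \<le> norm a + norm b" for n
    using norm_triangle_ineq[of a "(-1) ^ n * b"]
    unfolding complex_mod_cnj u_def by (simp add: norm_mult norm_power)
  have 1: "(\<lambda>N. 2 * Re ((1 / of_nat N) * (\<Sum>n=1..N. w n * cnj (u n)))) \<longlonglongrightarrow> 2 * Re 0"
    by (intro tendsto_intros null_mean_square_mult_bounded[OF w ub])
  have 2: "(\<lambda>N. Re ((1 / of_nat N) * (\<Sum>n=1..N. (-1) ^ n) * (2 * (a * cnj b)))) \<longlonglongrightarrow> Re (0 * (2 * (a * cnj b)))"
    by (intro tendsto_intros mean_power_tendsto_0) auto
  have "(cmod (u n + w n))\<^sup>2 = ((cmod a)\<^sup>2 + (cmod b)\<^sup>2) + Re ((-1) ^ n * (2 * (a * cnj b))) + 2 * Re (w n * cnj (u n)) + (norm (w n))\<^sup>2" for n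
  proof (cases "even n")
    case True
    then show ?thesis by (simp only: u_def cmod_power2) (simp add: power2_eq_square algebra_simps)
  next
    case False
    then show ?thesis by (simp only: u_def cmod_power2) (simp add: power2_eq_square algebra_simps)
  qed
  then have "(1 / real N) * (\<Sum>n=1..N. (cmod (a + (-1) ^ n * b + w n))\<^sup>2)
     = (1 / real N) * (\<Sum>n=1..N. (cmod a)\<^sup>2 + (cmod b)\<^sup>2)
       + Re ((1 / of_nat N) * (\<Sum>n=1..N. (-1) ^ n) * (2 * (a * cnj b)))
       + 2 * Re ((1 / of_nat N) * (\<Sum>n=1..N. w n * cnj (u n)))
       + (1 / real N) * (\<Sum>n=1..N. (norm (w n))\<^sup>2)" for N
  proof -
    have re: "Re ((1 / of_nat N) * z) = (1 / real N) * Re z" for z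
      by (metis Re_complex_of_real complex_scaleR scaleR_complex.sel(1) scaleR_conv_of_real of_real_1 of_real_divide of_real_of_nat_eq)
    show ?thesis
      unfolding u_def[symmetric] \<open>\<And>n. (cmod (u n + w n))\<^sup>2 = _ n\<close>
      by (simp only: mult.assoc re sum_distrib_right sum_distrib_left[symmetric] Re_sum sum.distrib)
         (simp add: algebra_simps sum_distrib_left del: One_nat_def)
  qed
  then show ?thesis
    using tendsto_add[OF tendsto_add[OF tendsto_add[OF mean_const 2] 1] w[unfolded null_mean_square_def]]
    by simp
qed

theorem walk_mean_probability:
  fixes \<phi> :: "'d::finite \<times> bool \<Rightarrow> complex"
  shows "(\<lambda>N. (1 / real N) * (\<Sum>n=1..N. p_std n \<phi> x))
         \<longlonglongrightarrow> vnorm2 (orth_proj (eigenspace_U 1) (delta0 \<phi>) x)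
             + vnorm2 (orth_proj (eigenspace_U (-1)) (delta0 \<phi>) x)"
proof -
  have l2: "in_ell2 (delta0 \<phi>)" by (simp add: delta0_eq)
  obtain w where w: "\<And>n x c. (U_std ^^ n) (delta0 \<phi>) x c = orth_proj (eigenspace_U 1) (delta0 \<phi>) x c
       + (-1) ^ n * orth_proj (eigenspace_U (-1)) (delta0 \<phi>) x c + w n x c"
    "\<And>x c. null_mean_square (\<lambda>n. w n x c)"
    by (rule walk_spectral_decomposition[OF l2]) blast
  have "(\<lambda>N. \<Sum>c\<in>UNIV. (1 / real N) * (\<Sum>n=1..N. (cmod (orth_proj (eigenspace_U 1) (delta0 \<phi>) x c
       + (-1) ^ n * orth_proj (eigenspace_U (-1)) (delta0 \<phi>) x c + w n x c))\<^sup>2))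
    \<longlonglongrightarrow> (\<Sum>c\<in>UNIV. (cmod (orth_proj (eigenspace_U 1) (delta0 \<phi>) x c))\<^sup>2
      + (cmod (orth_proj (eigenspace_U (-1)) (delta0 \<phi>) x c))\<^sup>2)"
    by (intro tendsto_sum mean_square_two_phases w(2))
  moreover have "(\<Sum>c\<in>UNIV. (1 / real N) * (\<Sum>n=1..N. (cmod (orth_proj (eigenspace_U 1) (delta0 \<phi>) x c
       + (-1) ^ n * orth_proj (eigenspace_U (-1)) (delta0 \<phi>) x c + w n x c))\<^sup>2))
     = (1 / real N) * (\<Sum>n=1..N. p_std n \<phi> x)" for N
    unfolding w(1)[symmetric] p_std_def vnorm2_def sum_distrib_left[symmetric]
    by (subst sum.swap) (rule refl)
  ultimately show ?thesis by (simp add: vnorm2_def sum.distrib)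
qed

text \<open>The isometry gives \<open>cmod \<mu> = 1\<close>. Undoing the rotation of the
  eigenvector leaves a constant, while the three parts of its decomposition all average to
  0.\<close>

lemma eigenvalue_walk_cases:
  assumes "is_eigenvalue_U TYPE('d::finite) \<mu>"
  shows "\<mu> = 1 \<or> \<mu> = -1"
proof (rule ccontr)
  assume \<mu>: "\<not> (\<mu> = 1 \<or> \<mu> = -1)"
  obtain f :: "('d \<Rightarrow> int) \<Rightarrow> 'd \<times> bool \<Rightarrow> complex" where f: "f \<in> eigenspace_U \<mu>" "f \<noteq> (\<lambda>x c. 0)"
    using assms by (auto simp: is_eigenvalue_U_def)
  have l2: "in_ell2 f" and Uf: "U_std f = (\<lambda>x c. \<mu> * f x c)" using f(1) by (auto simp: eigenspace_U_def)
  have "state f \<noteq> 0"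
    using f(2) l2 by (metis amp_state amp_zero)
  moreover have "norm (walk_op (state f)) = norm (state f)" by (rule norm_walk_op)
  then have "(norm (walk_op (state f)))\<^sup>2 = (norm (state f))\<^sup>2" by simp
  then have "(cmod \<mu>)\<^sup>2 * (norm (state f))\<^sup>2 = (norm (state f))\<^sup>2"
    by (simp add: norm_walk_state_square l2 Uf vnorm2_scale infsum_cmult_right')
  ultimately have n1: "cmod \<mu> = 1" by (simp add: power2_eq_1_iff) (use norm_ge_zero[of \<mu>] in linarith)
  then have unit: "cnj \<mu> ^ n * \<mu> ^ n = 1" for n
    by (metis complex_mod_sqrt_Re_mult_cnj complex_norm_square mult.commute of_real_1 power_mult_distrib power_one)
  obtain w where w: "\<And>n x c. (U_std ^^ n) f x c = orth_proj (eigenspace_U 1) f x c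
       + (-1) ^ n * orth_proj (eigenspace_U (-1)) f x c + w n x c"
    "\<And>x c. null_mean_square (\<lambda>n. w n x c)"
    by (rule walk_spectral_decomposition[OF l2]) blast
  have "f x c = 0" for x c
  proof -
    define g where "g = orth_proj (eigenspace_U 1) f x c"
    define h where "h = orth_proj (eigenspace_U (-1)) f x c"
    have "cnj \<mu> \<noteq> 1" "- cnj \<mu> \<noteq> 1"
      using \<mu> by (metis complex_cnj_cnj complex_cnj_one, metis complex_cnj_cnj complex_cnj_one complex_cnj_minus minus_minus)
    then have lim: "(\<lambda>N. (1 / of_nat N) * (\<Sum>n=1..N. cnj \<mu> ^ n) * g + (1 / of_nat N) * (\<Sum>n=1..N. (- cnj \<mu>) ^ n) * h
        + (1 / of_nat N) * (\<Sum>n=1..N. w n x c * cnj \<mu> ^ n)) \<longlonglongrightarrow> 0 * g + 0 * h + 0"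
      by (intro tendsto_intros mean_power_tendsto_0 null_mean_square_mult_bounded[OF w(2), of _ 1])
         (auto simp: n1 norm_power)
    \<comment> \<open>Multiplication by \<open>cnj \<mu> ^ n\<close> stops the eigenvector and makes
      the parts at 1 and -1 rotate by \<open>cnj \<mu>\<close> and \<open>- cnj \<mu>\<close>, both
      different from 1.\<close>
    have "f x c = cnj \<mu> ^ n * g + (- cnj \<mu>) ^ n * h + w n x c * cnj \<mu> ^ n" for n
    proof -
      have "f x c = cnj \<mu> ^ n * (\<mu> ^ n * f x c)" using unit[of n] by (simp add: mult.assoc[symmetric])
      also have "\<mu> ^ n * f x c = g + (-1) ^ n * h + w n x c"
        using U_std_funpow_eigenfunction[OF f(1), of n] w(1)[of n x c] by (simp add: g_def h_def)
      finally show ?thesis by (simp add: algebra_simps power_minus[of "cnj \<mu>"])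
    qed
    then have "(1 / of_nat N) * (\<Sum>n=1..N. f x c) = (1 / of_nat N) * (\<Sum>n=1..N. cnj \<mu> ^ n) * g + (1 / of_nat N) * (\<Sum>n=1..N. (- cnj \<mu>) ^ n) * h
        + (1 / of_nat N) * (\<Sum>n=1..N. w n x c * cnj \<mu> ^ n)" for N
    proof -
      have "(\<Sum>n=1..N. f x c) = (\<Sum>n=1..N. cnj \<mu> ^ n * g + (- cnj \<mu>) ^ n * h + w n x c * cnj \<mu> ^ n)"
        by (rule sum.cong) (use \<open>\<And>n. f x c = _ n\<close> in auto)
      then show ?thesis by (simp only: sum.distrib sum_distrib_right[symmetric] distrib_left mult.assoc)
    qed
    with lim have "(\<lambda>N. (1 / of_nat N) * (\<Sum>n=1..N. f x c)) \<longlonglongrightarrow> 0" by simp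
    moreover have "(\<lambda>N. (1 / of_nat N) * (\<Sum>n=1..N. f x c)) \<longlonglongrightarrow> f x c"
    proof (rule tendsto_eventually)
      show "\<forall>\<^sub>F N in sequentially. (1 / of_nat N) * (\<Sum>n=1..N. f x c) = f x c"
        using eventually_gt_at_top[of 0] by eventually_elim simp
    qed
    ultimately show ?thesis using LIMSEQ_unique by blast
  qed
  with f(2) show False by (auto simp: fun_eq_iff)
qed

text \<open>In Fourier space the eigenvector for the eigenvalue 1 has $\pm u_j$ components
  $\prod_{i} (1 + z_i)$ divided by $1 + z_j^{\pm 1}$, with $z_i$ the phase of a unit step.\<close>

definition cube :: "('d \<Rightarrow> int) \<Rightarrow> bool" where
  "cube x \<longleftrightarrow> (\<forall>i. x i = -1 \<or> x i = 0)"

text \<open>The product of all \<open>1 + z_i\<close> is the transform of the cube; cancelling the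
  factor of \<open>j\<close> leaves the face \<open>x j = 0\<close> for the positive direction and
  \<open>x j = -1\<close> for the negative one.\<close>

definition cube_state :: "('d::finite \<Rightarrow> int) \<Rightarrow> 'd \<times> bool \<Rightarrow> complex" where
  "cube_state x c = of_bool (cube x \<and> x (fst c) = (if snd c then 0 else -1))"

lemma finite_cube: "finite {x :: 'd::finite \<Rightarrow> int. cube x}"
proof -
  have "{x :: 'd \<Rightarrow> int. cube x} \<subseteq> PiE UNIV (\<lambda>_. {-1, 0})" by (auto simp: cube_def)
  then show ?thesis by (rule finite_subset) (intro finite_PiE; simp)
qed

text \<open>For each coordinate a site of the cube lies on exactly one of the two opposite
  faces.\<close>

lemma sum_cube_state: "(\<Sum>b\<in>UNIV. cube_state x b) = of_nat CARD('d) * of_bool (cube x)"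
  for x :: "'d::finite \<Rightarrow> int"
proof -
  have "(\<Sum>b\<in>UNIV. cube_state x b) = (\<Sum>j\<in>UNIV. \<Sum>s\<in>UNIV. cube_state x (j, s))"
    by (simp add: sum.cartesian_product)
  also have "\<dots> = (\<Sum>j\<in>(UNIV :: 'd set). of_bool (cube x))"
  proof (rule sum.cong)
    fix j :: 'd
    have "(\<Sum>s\<in>UNIV. cube_state x (j, s)) = cube_state x (j, False) + cube_state x (j, True)"
      by (simp add: UNIV_bool)
    also have "\<dots> = of_bool (cube x)"
    proof (cases "cube x")
      case True
      then have "x j = -1 \<or> x j = 0" by (simp add: cube_def)
      with True show ?thesis by (auto simp: cube_state_def)
    qed (simp add: cube_state_def)
    finally show "(\<Sum>s\<in>UNIV. cube_state x (j, s)) = of_bool (cube x)" .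
  qed simp
  finally show ?thesis by simp
qed

text \<open>The difference on the left is the indicator of the face opposite to that of
  \<open>c\<close>, and the unit step in direction \<open>c\<close> carries this face onto its
  own.\<close>

lemma cube_state_step:
  "of_bool (cube (\<lambda>i. x i - std_dir c i)) - cube_state (\<lambda>i. x i - std_dir c i) c = cube_state x c"
proof -
  obtain j s where c: "c = (j, s)" by (cases c)
  have cube_split: "cube y \<longleftrightarrow> (y j = -1 \<or> y j = 0) \<and> (\<forall>i. i \<noteq> j \<longrightarrow> y i = -1 \<or> y i = 0)" for y
    unfolding cube_def by metis
  define R where "R \<longleftrightarrow> (\<forall>i. i \<noteq> j \<longrightarrow> x i = -1 \<or> x i = 0)"
  have rest: "(\<forall>i. i \<noteq> j \<longrightarrow> x i - std_dir c i = -1 \<or> x i - std_dir c i = 0)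
     \<longleftrightarrow> (\<forall>i. i \<noteq> j \<longrightarrow> x i = -1 \<or> x i = 0)"
    by (simp add: c std_dir_def)
  have "cube (\<lambda>i. x i - std_dir c i) \<and> x j - std_dir c j \<noteq> (if s then 0 else -1)
     \<longleftrightarrow> cube x \<and> x j = (if s then 0 else -1)"
    unfolding cube_split rest R_def[symmetric] by (cases s; cases R) (auto simp: c std_dir_def)
  moreover have "of_bool P - of_bool (P \<and> Q) = (of_bool (P \<and> \<not> Q) :: complex)" for P Q
    by (cases Q) auto
  ultimately show ?thesis by (simp only: cube_state_def c fst_conv snd_conv)
qed

lemma cube_state_eigenvector: "cube_state \<in> eigenspace_U 1"
proof -
  have "in_ell2 cube_state"
    by (rule in_ell2_finite_support[OF finite_cube]) (auto simp: cube_state_def)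
  moreover have "U_std cube_state = (\<lambda>x c. 1 * cube_state x c)"
    by (intro ext) (simp add: U_std_def grover_eq sum_cube_state cube_state_step)
  ultimately show ?thesis by (simp add: eigenspace_U_def)
qed

definition site_sign :: "('d::finite \<Rightarrow> int) \<Rightarrow> complex" where
  "site_sign x = (if even (\<Sum>i\<in>UNIV. x i) then 1 else -1)"

lemma site_sign_step: "site_sign (\<lambda>i. x i - std_dir c i) = - site_sign x"
proof -
  have "(\<Sum>i\<in>UNIV. std_dir c i) = (if snd c then 1 else -1)"
    by (simp add: std_dir_def)
  then show ?thesis by (auto simp: site_sign_def sum_subtractf)
qed

text \<open>Every step changes the parity of the site, so multiplication by the checkerboard sign
  conjugates \<open>U_std\<close> into its negative.\<close>

lemma staggered_eigenvector:
  assumes "f \<in> eigenspace_U 1"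
  shows "(\<lambda>x c. site_sign x * f x c) \<in> eigenspace_U (-1)"
proof -
  have "in_ell2 (\<lambda>x c. site_sign x * f x c)"
    by (rule in_ell2_comparison[of f _ 1])
       (use assms in \<open>auto simp: eigenspace_U_def vnorm2_scale site_sign_def\<close>)
  moreover have "U_std (\<lambda>x c. site_sign x * f x c) = (\<lambda>x c. - site_sign x * U_std f x c)"
    by (intro ext) (simp only: U_std_def grover_linear site_sign_step)
  ultimately show ?thesis using assms by (simp add: eigenspace_U_def)
qed

lemma cube_state_origin: "cube_state (\<lambda>i. 0) c = of_bool (snd c)"
  by (simp add: cube_state_def cube_def)

lemma is_eigenvalue_walk: "is_eigenvalue_U TYPE('d::finite) 1" "is_eigenvalue_U TYPE('d) (-1)"
proof -
  have "cube_state (\<lambda>i. 0) (undefined :: 'd, True) \<noteq> 0" by (simp add: cube_state_origin)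
  moreover have "site_sign (\<lambda>i :: 'd. 0) = 1" by (simp add: site_sign_def)
  ultimately have "cube_state \<noteq> (\<lambda>x (c :: 'd \<times> bool). 0)" "(\<lambda>x (c :: 'd \<times> bool). site_sign x * cube_state x c) \<noteq> (\<lambda>x c. 0)"
    by (metis, metis mult_1)
  then show "is_eigenvalue_U TYPE('d::finite) 1" "is_eigenvalue_U TYPE('d) (-1)"
    unfolding is_eigenvalue_U_def
    using cube_state_eigenvector staggered_eigenvector[OF cube_state_eigenvector] by blast+
qed

section \<open>Localization from a positive mean probability\<close>

lemma limsup_pos_of_mean:
  fixes p :: "nat \<Rightarrow> real"
  assumes p: "\<And>n. 0 \<le> p n" and lim: "(\<lambda>N. (1 / real N) * (\<Sum>n=1..N. p n)) \<longlonglongrightarrow> L" and L: "0 < L"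
  shows "0 < limsup (\<lambda>n. ereal (p n))"
proof (rule ccontr)
  assume "\<not> 0 < limsup (\<lambda>n. ereal (p n))"
  then have "limsup (\<lambda>n. ereal (p n)) < ereal e" if "0 < e" for e
    using that by (metis ereal_less(2) not_less order.strict_trans1)
  then have "\<forall>\<^sub>F n in sequentially. p n < e" if "0 < e" for e
    using Limsup_lessD[where y = "ereal e" and F = sequentially and f = "\<lambda>n. ereal (p n)"] that by simp
  then have "p \<longlonglongrightarrow> 0"
    using p by (intro order_tendstoI) (auto intro: always_eventually order.strict_trans2)
  \<comment> \<open>Square roots compensate for the square inside \<open>null_mean_square\<close>,
    so Cesaro convergence follows from \<open>null_mean_square_LIMSEQ_0\<close>.\<close>
  then have "(\<lambda>n. sqrt (p n)) \<longlonglongrightarrow> 0" using tendsto_real_sqrt by fastforce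
  then have "null_mean_square (\<lambda>n. sqrt (p n))" by (rule null_mean_square_LIMSEQ_0)
  then have "(\<lambda>N. (1 / real N) * (\<Sum>n=1..N. p n)) \<longlonglongrightarrow> 0"
    using p by (simp add: null_mean_square_def)
  with lim L show False using LIMSEQ_unique by blast
qed

lemma walk_localization:
  "\<exists>(\<phi>::'d::finite \<times> bool \<Rightarrow> complex) x. 0 < limsup (\<lambda>n. ereal (p_std n \<phi> x))"
proof -
  \<comment> \<open>Starting from the value of the eigenvector at the origin makes the overlap of
    \<open>cube_state\<close> with \<open>delta0 \<phi>\<close> equal to
    \<open>vnorm2 \<phi>\<close>, so the projection cannot vanish.\<close>
  define \<phi> :: "'d \<times> bool \<Rightarrow> complex" where "\<phi> = cube_state (\<lambda>i. 0)"
  let ?P = "orth_proj (eigenspace_U 1) (delta0 \<phi>)"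
  have "in_ell2 (delta0 \<phi>)" by (simp add: delta0_eq)
  then have "ell2_inner cube_state (delta0 \<phi>) = ell2_inner cube_state ?P"
    by (rule walk_spectral_decomposition) (use cube_state_eigenvector in blast)
  moreover have "ell2_inner cube_state (delta0 \<phi>) = of_real (vnorm2 \<phi>)"
    by (subst ell2_inner_cnj) (simp add: delta0_eq ell2_inner_delta \<phi>_def vinner_self)
  moreover have "vnorm2 \<phi> \<noteq> 0"
    unfolding vnorm2_eq_0_iff by (auto simp: \<phi>_def cube_state_origin fun_eq_iff)
  ultimately have "ell2_inner cube_state ?P \<noteq> 0" by (metis of_real_eq_0_iff)
  then have "?P \<noteq> (\<lambda>x c. 0)" by (auto simp: ell2_inner_def)
  then obtain x where "?P x \<noteq> (\<lambda>c. 0)" by (auto simp: fun_eq_iff)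
  then have "0 < vnorm2 (?P x)" using vnorm2_nonneg[of "?P x"] vnorm2_eq_0_iff[of "?P x"] by linarith
  then have "0 < limsup (\<lambda>n. ereal (p_std n \<phi> x))"
    by (intro limsup_pos_of_mean[OF _ walk_mean_probability]) (auto simp: p_std_def intro: add_pos_nonneg)
  then show ?thesis by blast
qed

theorem mainTheorem2:
  assumes "CARD('d::finite) \<ge> 2"
  shows "is_eigenvalue_U TYPE('d) 1 \<and> is_eigenvalue_U TYPE('d) (-1)
    \<and> (\<forall>mu. is_eigenvalue_U TYPE('d) mu \<longrightarrow> mu = 1 \<or> mu = -1)
    \<and> (\<forall>(\<phi>::'d \<times> bool \<Rightarrow> complex) (x::'d \<Rightarrow> int).
         (\<lambda>N. (1 / real N) * (\<Sum>n=1..N. p_std n \<phi> x))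
         \<longlonglongrightarrow> vnorm2 (orth_proj (eigenspace_U 1) (delta0 \<phi>) x)
             + vnorm2 (orth_proj (eigenspace_U (-1)) (delta0 \<phi>) x))
    \<and> (\<exists>(\<phi>o::'d \<times> bool \<Rightarrow> complex) (xo::'d \<Rightarrow> int).
         limsup (\<lambda>n. ereal (p_std n \<phi>o xo)) > 0)"
  using is_eigenvalue_walk eigenvalue_walk_cases walk_mean_probability walk_localization by blast

end
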